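(* The class of $GB\widetilde{W}$ metrics on a manifold $M$ is closed under C-projective changes. That is, if $F$ and $\widetilde F$ are Finsler metrics on $M$ such that $F$ is a $GB\widetilde W$ metric and $\widetilde F$ is obtained from $F$ by a C-projective change, then $\widetilde F$ is also a $GB\widetilde W$ metric.
   Context: Finsler metric: a nonnegative function $F$ on $TM$, smooth on $TM_0=TM\setminus\{0\}$, with $F(\lambda y)=\lambda F(y)$ for $\lambda>0$, such that $g_{ij}(x,y)=\frac12\frac{\partial^2F^2}{\partial y^i\partial y^j}$ is positive definite on $TM_0$; $(g^{ij})$ is the inverse matrix. Einstein summation is used. All tensors are tensor fields along $TM_0$ (their components are functions of $(x,y)$, $y\neq0$). Spray coefficients: $G^i=\frac14 g^{il}\left\{\frac{\partial^2F^2}{\partial x^k\partial y^l}y^k-\frac{\partial F^2}{\partial x^l}\right\}$; $G^i_j=\frac{\partial G^i}{\partial y^j}$, $G^i_{jk}=\frac{\partial^2G^i}{\partial y^j\partial y^k}$. Horizontal covariant derivative of the Berwald connection, denoted $\mid$: with $\frac{\delta}{\delta x^m}=\frac{\partial}{\partial x^m}-G^r_m\frac{\partial}{\partial y^r}$, $T_j{}^i{}_{\mid m}=\frac{\delta T_j{}^i}{\delta x^m}+T_j{}^rG^i_{rm}-T_r{}^iG^r_{jm}$, and analogously for tensors with more indices. Berwald curvature: $B_j{}^i{}_{kl}=\frac{\partial^3G^i}{\partial y^j\partial y^k\partial y^l}$. $GB\widetilde W$ metric: $B_j{}^i{}_{kl}=\beta_j{}^i{}_{kl}+b_{jkl}y^i$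 for some tensors $b_{jkl}$ and $\beta_j{}^i{}_{kl}$ with $\beta_j{}^i{}_{kl\mid m}y^m=0$ (all quantities computed for the metric in question). C-projective change: $\widetilde F$ is obtained from $F$ by a projective change if their spray coefficients satisfy $\widetilde G^i=G^i+Py^i$ for a scalar function $P=P(x,y)$ (the projective factor), smooth on $TM_0$ and positively homogeneous of degree one in $y$. The change is C-projective if moreover $Q_{ij}=0$, where $$Q_{ij}=\frac{\partial Q_j}{\partial y^i}-\frac{\partial Q_i}{\partial y^j},\qquad Q_i=\frac{\partial P}{\partial x^i}-G^m_i\frac{\partial P}{\partial y^m}-P\frac{\partial P}{\partial y^i}.$$ *)

theory Defs
  imports "HOL-Analysis.Analysis"
begin

primrec Ck_on :: "nat \<Rightarrow> 'a::euclidean_space set \<Rightarrow> ('a \<Rightarrow> 'b::real_normed_vector) \<Rightarrow> bool" where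
  "Ck_on 0 S f \<longleftrightarrow> continuous_on S f"
| "Ck_on (Suc k) S f \<longleftrightarrow> (\<forall>x\<in>S. f differentiable (at x)) \<and>
     (\<forall>v. Ck_on k S (\<lambda>x. frechet_derivative f (at x) v))"

text \<open>Only meaningful for open \<open>S\<close>, since derivatives are taken at \<open>at x\<close>.\<close>

definition smooth_on :: "'a::euclidean_space set \<Rightarrow> ('a \<Rightarrow> 'b::real_normed_vector) \<Rightarrow> bool" where
  "smooth_on S f \<longleftrightarrow> (\<forall>k. Ck_on k S f)"

text \<open>A chart is a pair \<open>(U, \<phi>)\<close>; the values of \<open>\<phi>\<close> outside \<open>U\<close> are irrelevant.\<close>

type_synonym ('m, 'n) chart = "'m set \<times> ('m \<Rightarrow> real ^ 'n)"

definition chart_image :: "('m, 'n) chart \<Rightarrow> (real ^ 'n) set" where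
  "chart_image c = snd c ` fst c"

definition chart_inv :: "('m, 'n) chart \<Rightarrow> real ^ 'n \<Rightarrow> 'm" where
  "chart_inv c = inv_into (fst c) (snd c)"

definition transition :: "('m, 'n) chart \<Rightarrow> ('m, 'n) chart \<Rightarrow> real ^ 'n \<Rightarrow> real ^ 'n" where
  "transition c c' x = snd c' (chart_inv c x)"

definition is_chart :: "'m topology \<Rightarrow> ('m, 'n::finite) chart \<Rightarrow> bool" where
  "is_chart M c \<longleftrightarrow> openin M (fst c) \<and> open (chart_image c) \<and>
     homeomorphic_map (subtopology M (fst c)) (top_of_set (chart_image c)) (snd c)"

text \<open>The atlas is not required to be maximal.\<close>

definition smooth_manifold :: "'m topology \<Rightarrow> ('m, 'n::finite) chart set \<Rightarrow> bool" where
  "smooth_manifold M A \<longleftrightarrow> Hausdorff_space M \<and> second_countable M \<and>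
     (\<forall>c\<in>A. is_chart M c) \<and> (\<Union>c\<in>A. fst c) = topspace M \<and>
     (\<forall>c\<in>A. \<forall>c'\<in>A. smooth_on (snd c ` (fst c \<inter> fst c')) (transition c c'))"

text \<open>
  A tangent vector at \<open>p\<close> is the family of its component vectors in all charts of the atlas around
  \<open>p\<close>, related by the Jacobians of the coordinate changes; the components in other charts are
  set to \<open>0\<close>, so that a tangent vector is determined by its components in any chart around \<open>p\<close>.
\<close>

type_synonym ('m, 'n) tvec = "('m, 'n) chart \<Rightarrow> real ^ 'n"

definition tangent_space :: "('m, 'n::finite) chart set \<Rightarrow> 'm \<Rightarrow> ('m, 'n) tvec set" where
  "tangent_space A p = {v.
     (\<forall>c. c \<notin> A \<or> p \<notin> fst c \<longrightarrow> v c = 0) \<and>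
     (\<forall>c\<in>A. \<forall>c'\<in>A. p \<in> fst c \<inter> fst c' \<longrightarrow>
        v c' = jacobian (transition c c') (at (snd c p)) *v v c)}"

definition tangent_bundle ::
    "'m topology \<Rightarrow> ('m, 'n::finite) chart set \<Rightarrow> ('m \<times> ('m, 'n) tvec) set" where
  "tangent_bundle M A = Sigma (topspace M) (tangent_space A)"

definition tzero :: "('m, 'n::finite) tvec" where
  "tzero = (\<lambda>c. 0)"

definition tscale :: "real \<Rightarrow> ('m, 'n::finite) tvec \<Rightarrow> ('m, 'n) tvec" where
  "tscale a v = (\<lambda>c. a *\<^sub>R v c)"

definition slit_tangent_bundle ::
    "'m topology \<Rightarrow> ('m, 'n::finite) chart set \<Rightarrow> ('m \<times> ('m, 'n) tvec) set" where
  "slit_tangent_bundle M A = {(p, v) \<in> tangent_bundle M A. v \<noteq> tzero}"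

text \<open>The tangent vector \<open>y\<^sup>i \<partial>/\<partial>x\<^sup>i\<close> at \<open>p\<close> with respect to the chart \<open>c\<close>.\<close>

definition tvec_of ::
    "('m, 'n::finite) chart set \<Rightarrow> ('m, 'n) chart \<Rightarrow> 'm \<Rightarrow> real ^ 'n \<Rightarrow> ('m, 'n) tvec" where
  "tvec_of A c p y = (\<lambda>c'. if c' \<in> A \<and> p \<in> fst c'
     then jacobian (transition c c') (at (snd c p)) *v y else 0)"

text \<open>
  The coordinate expression \<open>f(x, y)\<close>, in the chart \<open>c\<close>, of a function \<open>f\<close> on the (slit) tangent
  bundle.  It is only meaningful for \<open>x \<in> chart_image c\<close>.
\<close>

definition local_expr :: "('m, 'n::finite) chart set \<Rightarrow> ('m, 'n) chart \<Rightarrow>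
    ('m \<times> ('m, 'n) tvec \<Rightarrow> real) \<Rightarrow> real ^ 'n \<Rightarrow> real ^ 'n \<Rightarrow> real" where
  "local_expr A c f x y = f (chart_inv c x, tvec_of A c (chart_inv c x) y)"

definition smooth_comp :: "('m, 'n::finite) chart \<Rightarrow> (real ^ 'n \<Rightarrow> real ^ 'n \<Rightarrow> real) \<Rightarrow> bool" where
  "smooth_comp c f \<longleftrightarrow> smooth_on (chart_image c \<times> (- {0})) (\<lambda>(x, y). f x y)"

definition smooth_slit :: "('m, 'n::finite) chart set \<Rightarrow> ('m \<times> ('m, 'n) tvec \<Rightarrow> real) \<Rightarrow> bool" where
  "smooth_slit A f \<longleftrightarrow> (\<forall>c\<in>A. smooth_comp c (local_expr A c f))"

text \<open>
  A tensor field is given by its components in every chart.  In \<open>\<beta> c j i k l x y\<close> the index \<open>i\<close> is the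
  contravariant one.
\<close>

definition tensor_field_13 :: "('m, 'n::finite) chart set \<Rightarrow>
    (('m, 'n) chart \<Rightarrow> 'n \<Rightarrow> 'n \<Rightarrow> 'n \<Rightarrow> 'n \<Rightarrow> real ^ 'n \<Rightarrow> real ^ 'n \<Rightarrow> real) \<Rightarrow> bool" where
  "tensor_field_13 A \<beta> \<longleftrightarrow>
     (\<forall>c\<in>A. \<forall>j i k l. smooth_comp c (\<beta> c j i k l)) \<and>
     (\<forall>c\<in>A. \<forall>c'\<in>A. \<forall>p\<in>fst c \<inter> fst c'. \<forall>y. y \<noteq> 0 \<longrightarrow>
        (let x = snd c p; x' = snd c' p;
             J = jacobian (transition c c') (at x);
             K = jacobian (transition c' c) (at x')
         in \<forall>j i k l. \<beta> c j i k l x y =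
              (\<Sum>b\<in>UNIV. \<Sum>a\<in>UNIV. \<Sum>d\<in>UNIV. \<Sum>e\<in>UNIV.
                 K $ i $ a * \<beta> c' b a d e x' (J *v y) * J $ b $ j * J $ d $ k * J $ e $ l)))"

definition tensor_field_03 :: "('m, 'n::finite) chart set \<Rightarrow>
    (('m, 'n) chart \<Rightarrow> 'n \<Rightarrow> 'n \<Rightarrow> 'n \<Rightarrow> real ^ 'n \<Rightarrow> real ^ 'n \<Rightarrow> real) \<Rightarrow> bool" where
  "tensor_field_03 A b \<longleftrightarrow>
     (\<forall>c\<in>A. \<forall>j k l. smooth_comp c (b c j k l)) \<and>
     (\<forall>c\<in>A. \<forall>c'\<in>A. \<forall>p\<in>fst c \<inter> fst c'. \<forall>y. y \<noteq> 0 \<longrightarrow>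
        (let x = snd c p; x' = snd c' p;
             J = jacobian (transition c c') (at x)
         in \<forall>j k l. b c j k l x y =
              (\<Sum>r\<in>UNIV. \<Sum>d\<in>UNIV. \<Sum>e\<in>UNIV.
                 b c' r d e x' (J *v y) * J $ r $ j * J $ d $ k * J $ e $ l)))"

definition dx :: "'n::finite \<Rightarrow> (real ^ 'n \<Rightarrow> real ^ 'n \<Rightarrow> real) \<Rightarrow> real ^ 'n \<Rightarrow> real ^ 'n \<Rightarrow> real" where
  "dx i f x y = deriv (\<lambda>t. f (x + t *\<^sub>R axis i 1) y) 0"

definition dy :: "'n::finite \<Rightarrow> (real ^ 'n \<Rightarrow> real ^ 'n \<Rightarrow> real) \<Rightarrow> real ^ 'n \<Rightarrow> real ^ 'n \<Rightarrow> real" where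
  "dy i f x y = deriv (\<lambda>t. f x (y + t *\<^sub>R axis i 1)) 0"

definition fsq :: "(real ^ 'n::finite \<Rightarrow> real ^ 'n \<Rightarrow> real) \<Rightarrow> real ^ 'n \<Rightarrow> real ^ 'n \<Rightarrow> real" where
  "fsq F x y = (F x y)\<^sup>2"

definition fund_tensor ::
    "(real ^ 'n::finite \<Rightarrow> real ^ 'n \<Rightarrow> real) \<Rightarrow> real ^ 'n \<Rightarrow> real ^ 'n \<Rightarrow> real ^ 'n ^ 'n" where
  "fund_tensor F x y = (\<chi> i j. 1 / 2 * dy i (dy j (fsq F)) x y)"

definition spray :: "(real ^ 'n::finite \<Rightarrow> real ^ 'n \<Rightarrow> real) \<Rightarrow>
    'n \<Rightarrow> real ^ 'n \<Rightarrow> real ^ 'n \<Rightarrow> real" where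
  "spray F i x y = 1 / 4 * (\<Sum>l\<in>UNIV. matrix_inv (fund_tensor F x y) $ i $ l *
     ((\<Sum>k\<in>UNIV. dx k (dy l (fsq F)) x y * y $ k) - dx l (fsq F) x y))"

text \<open>\<open>spray1 F i j\<close> is \<open>G\<^sup>i\<^sub>j\<close> and \<open>spray2 F i j k\<close> is \<open>G\<^sup>i\<^sub>j\<^sub>k\<close>.\<close>

definition spray1 :: "(real ^ 'n::finite \<Rightarrow> real ^ 'n \<Rightarrow> real) \<Rightarrow>
    'n \<Rightarrow> 'n \<Rightarrow> real ^ 'n \<Rightarrow> real ^ 'n \<Rightarrow> real" where
  "spray1 F i j = dy j (spray F i)"

definition spray2 :: "(real ^ 'n::finite \<Rightarrow> real ^ 'n \<Rightarrow> real) \<Rightarrow>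
    'n \<Rightarrow> 'n \<Rightarrow> 'n \<Rightarrow> real ^ 'n \<Rightarrow> real ^ 'n \<Rightarrow> real" where
  "spray2 F i j k = dy j (dy k (spray F i))"

definition berwald_curv :: "(real ^ 'n::finite \<Rightarrow> real ^ 'n \<Rightarrow> real) \<Rightarrow>
    'n \<Rightarrow> 'n \<Rightarrow> 'n \<Rightarrow> 'n \<Rightarrow> real ^ 'n \<Rightarrow> real ^ 'n \<Rightarrow> real" where
  "berwald_curv F j i k l = dy j (dy k (dy l (spray F i)))"

definition hor_deriv :: "(real ^ 'n::finite \<Rightarrow> real ^ 'n \<Rightarrow> real) \<Rightarrow> 'n \<Rightarrow>
    (real ^ 'n \<Rightarrow> real ^ 'n \<Rightarrow> real) \<Rightarrow> real ^ 'n \<Rightarrow> real ^ 'n \<Rightarrow> real" where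
  "hor_deriv F m f x y = dx m f x y - (\<Sum>r\<in>UNIV. spray1 F r m x y * dy r f x y)"

text \<open>\<open>T\<^sub>j\<^sup>i\<^sub>k\<^sub>l\<^sub>|\<^sub>m\<close> for the Berwald connection of \<open>F\<close>.\<close>

definition berwald_cov :: "(real ^ 'n::finite \<Rightarrow> real ^ 'n \<Rightarrow> real) \<Rightarrow>
    ('n \<Rightarrow> 'n \<Rightarrow> 'n \<Rightarrow> 'n \<Rightarrow> real ^ 'n \<Rightarrow> real ^ 'n \<Rightarrow> real) \<Rightarrow>
    'n \<Rightarrow> 'n \<Rightarrow> 'n \<Rightarrow> 'n \<Rightarrow> 'n \<Rightarrow> real ^ 'n \<Rightarrow> real ^ 'n \<Rightarrow> real" where
  "berwald_cov F T j i k l m x y = hor_deriv F m (T j i k l) x y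
     + (\<Sum>r\<in>UNIV. T j r k l x y * spray2 F i r m x y)
     - (\<Sum>r\<in>UNIV. T r i k l x y * spray2 F r j m x y)
     - (\<Sum>r\<in>UNIV. T j i r l x y * spray2 F r k m x y)
     - (\<Sum>r\<in>UNIV. T j i k r x y * spray2 F r l m x y)"

definition finsler_metric :: "'m topology \<Rightarrow> ('m, 'n::finite) chart set \<Rightarrow>
    ('m \<times> ('m, 'n) tvec \<Rightarrow> real) \<Rightarrow> bool" where
  "finsler_metric M A F \<longleftrightarrow>
     (\<forall>(p, v)\<in>tangent_bundle M A. F (p, v) \<ge> 0) \<and>
     smooth_slit A F \<and>
     (\<forall>(p, v)\<in>tangent_bundle M A. \<forall>a>0. F (p, tscale a v) = a * F (p, v)) \<and>
     (\<forall>c\<in>A. \<forall>x\<in>chart_image c. \<forall>y. y \<noteq> 0 \<longrightarrow>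
        (\<forall>\<xi>. \<xi> \<noteq> 0 \<longrightarrow> \<xi> \<bullet> (fund_tensor (local_expr A c F) x y *v \<xi>) > 0))"

definition GBW_metric :: "'m topology \<Rightarrow> ('m, 'n::finite) chart set \<Rightarrow>
    ('m \<times> ('m, 'n) tvec \<Rightarrow> real) \<Rightarrow> bool" where
  "GBW_metric M A F \<longleftrightarrow> finsler_metric M A F \<and>
     (\<exists>\<beta> b. tensor_field_13 A \<beta> \<and> tensor_field_03 A b \<and>
        (\<forall>c\<in>A. \<forall>x\<in>chart_image c. \<forall>y. y \<noteq> 0 \<longrightarrow> (\<forall>j i k l.
           berwald_curv (local_expr A c F) j i k l x y = \<beta> c j i k l x y + b c j k l x y * y $ i \<and>
           (\<Sum>m\<in>UNIV. berwald_cov (local_expr A c F) (\<beta> c) j i k l m x y * y $ m) = 0)))"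

definition projective_change :: "'m topology \<Rightarrow> ('m, 'n::finite) chart set \<Rightarrow>
    ('m \<times> ('m, 'n) tvec \<Rightarrow> real) \<Rightarrow> ('m \<times> ('m, 'n) tvec \<Rightarrow> real) \<Rightarrow>
    ('m \<times> ('m, 'n) tvec \<Rightarrow> real) \<Rightarrow> bool" where
  "projective_change M A F F' P \<longleftrightarrow>
     smooth_slit A P \<and>
     (\<forall>(p, v)\<in>slit_tangent_bundle M A. \<forall>a>0. P (p, tscale a v) = a * P (p, v)) \<and>
     (\<forall>c\<in>A. \<forall>x\<in>chart_image c. \<forall>y. y \<noteq> 0 \<longrightarrow> (\<forall>i.
        spray (local_expr A c F') i x y =
          spray (local_expr A c F) i x y + local_expr A c P x y * y $ i))"

definition Q1 :: "(real ^ 'n::finite \<Rightarrow> real ^ 'n \<Rightarrow> real) \<Rightarrow>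
    (real ^ 'n \<Rightarrow> real ^ 'n \<Rightarrow> real) \<Rightarrow> 'n \<Rightarrow> real ^ 'n \<Rightarrow> real ^ 'n \<Rightarrow> real" where
  "Q1 F P i x y =
     dx i P x y - (\<Sum>m\<in>UNIV. spray1 F m i x y * dy m P x y) - P x y * dy i P x y"

definition Q2 :: "(real ^ 'n::finite \<Rightarrow> real ^ 'n \<Rightarrow> real) \<Rightarrow>
    (real ^ 'n \<Rightarrow> real ^ 'n \<Rightarrow> real) \<Rightarrow> 'n \<Rightarrow> 'n \<Rightarrow> real ^ 'n \<Rightarrow> real ^ 'n \<Rightarrow> real" where
  "Q2 F P i j x y = dy i (Q1 F P j) x y - dy j (Q1 F P i) x y"

definition C_projective_change :: "'m topology \<Rightarrow> ('m, 'n::finite) chart set \<Rightarrow>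
    ('m \<times> ('m, 'n) tvec \<Rightarrow> real) \<Rightarrow> ('m \<times> ('m, 'n) tvec \<Rightarrow> real) \<Rightarrow> bool" where
  "C_projective_change M A F F' \<longleftrightarrow>
     (\<exists>P. projective_change M A F F' P \<and>
        (\<forall>c\<in>A. \<forall>x\<in>chart_image c. \<forall>y. y \<noteq> 0 \<longrightarrow> (\<forall>i j.
           Q2 (local_expr A c F) (local_expr A c P) i j x y = 0)))"

end

theory Submission
  imports Defs
begin

text \<open>
  Write \<open>D\<close> for the covariant derivative \<open>T\<^sub>|\<^sub>m y\<^sup>m\<close> along the spray.  Since \<open>D y\<^sup>i = 0\<close>, the
  hypothesis on \<open>F\<close> makes \<open>D B\<close> a multiple of \<open>y\<^sup>i\<close>.  A projective change adds to the Berwald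
  curvature a multiple of \<open>y\<^sup>i\<close> and terms of the form \<open>P\<^sub>j\<^sub>k \<delta>\<^sup>i\<^sub>l\<close>, where \<open>P\<^sub>j\<^sub>k\<close> is the vertical Hessian
  of \<open>P\<close>; the condition \<open>Q\<^sub>i\<^sub>j = 0\<close> gives \<open>D P\<^sub>j\<^sub>k = 0\<close>.  For tensors of the homogeneity and
  transversality of the Berwald curvature, the operators \<open>D\<close> of the two sprays differ by a multiple of
  \<open>y\<^sup>i\<close>.  Hence the new curvature satisfies \<open>D B = a y\<^sup>i\<close> with respect to the new spray, and removing
  its component along \<open>y\<^sup>i\<close>, measured with the parallel covector \<open>y\<^sub>i / F\<^sup>2\<close> of the new metric, leaves
  a tensor \<open>\<beta>\<close> with \<open>D \<beta> = 0\<close>.  That the new curvature is a tensor follows from the decomposition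
  of the old one and the invariance of \<open>P\<close>.
\<close>

section \<open>Smooth functions\<close>

text \<open>On an open set a derivative depends only on nearby values, so agreement on
  \<open>S\<close> passes to all derivatives. The later rules use this to replace
  \<open>frechet_derivative\<close> by an explicit formula inside \<open>S\<close>.\<close>

lemma Ck_on_cong:
  assumes "open S" "\<And>x. x \<in> S \<Longrightarrow> f x = g x" "Ck_on k S f"
  shows "Ck_on k S g"
  using assms(2,3)
proof (induction k arbitrary: f g)
  case 0
  then show ?case by (metis Ck_on.simps(1) continuous_on_cong)
next
  case (Suc k)
  have "g differentiable at x" if "x \<in> S" for x
    using Suc.prems that assms(1) has_derivative_transform_within_open[of f _ x UNIV S g]
    unfolding differentiable_def by (metis Ck_on.simps(2) differentiable_def)
  moreover have "Ck_on k S (\<lambda>x. frechet_derivative g (at x) v)" for v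
  proof (rule Suc.IH)
    show "Ck_on k S (\<lambda>x. frechet_derivative f (at x) v)"
      using Suc.prems(2) by simp
    show "frechet_derivative f (at x) v = frechet_derivative g (at x) v" if "x \<in> S" for x
      using frechet_derivative_transform_within_open[of f x S g] Suc.prems that assms(1) by simp
  qed
  ultimately show ?case by simp
qed

lemma Ck_on_Suc_imp: "Ck_on (Suc k) S f \<Longrightarrow> Ck_on k S f"
proof (induction k arbitrary: f)
  case 0
  then show ?case
    by (auto intro!: differentiable_imp_continuous_on differentiable_at_imp_differentiable_on)
qed auto

lemma Ck_on_const: "Ck_on k S (\<lambda>x. c)"
  by (induction k arbitrary: c) auto

lemma Ck_on_linear:
  assumes "bounded_linear f" shows "Ck_on k S f"
proof (cases k)
  case 0
  then show ?thesis using assms by (simp add: linear_continuous_on)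
next
  case (Suc m)
  have "frechet_derivative f (at x) = f" for x
    using frechet_derivative_at[OF bounded_linear_imp_has_derivative[OF assms]] by simp
  then show ?thesis
    using Suc assms by (auto intro: Ck_on_const bounded_linear_imp_differentiable)
qed

lemma Ck_on_add:
  assumes "open S" "Ck_on k S f" "Ck_on k S g"
  shows "Ck_on k S (\<lambda>x. f x + g x)"
  using assms(2,3)
proof (induction k arbitrary: f g)
  case 0
  then show ?case by (auto intro: continuous_on_add)
next
  case (Suc k)
  have "Ck_on k S (\<lambda>x. frechet_derivative (\<lambda>x. f x + g x) (at x) v)" for v
  proof (rule Ck_on_cong[OF assms(1)])
    show "Ck_on k S (\<lambda>x. frechet_derivative f (at x) v + frechet_derivative g (at x) v)"
      using Suc by simp
    show "frechet_derivative f (at x) v + frechet_derivative g (at x) v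
        = frechet_derivative (\<lambda>x. f x + g x) (at x) v" if "x \<in> S" for x
      using frechet_derivative_at[OF has_derivative_add[of f "frechet_derivative f (at x)" "at x" g
          "frechet_derivative g (at x)"]] Suc.prems that
      by (simp add: frechet_derivative_works[symmetric] fun_eq_iff)
  qed
  then show ?case using Suc.prems by auto
qed

lemma Ck_on_mult:
  fixes f g :: "'a::euclidean_space \<Rightarrow> real"
  assumes "open S" "Ck_on k S f" "Ck_on k S g"
  shows "Ck_on k S (\<lambda>x. f x * g x)"
  using assms(2,3)
proof (induction k arbitrary: f g)
  case 0
  then show ?case by (auto intro: continuous_on_mult)
next
  case (Suc k)
  have "Ck_on k S (\<lambda>x. frechet_derivative (\<lambda>x. f x * g x) (at x) v)" for v
  proof (rule Ck_on_cong[OF assms(1)])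
    show "Ck_on k S (\<lambda>x. f x * frechet_derivative g (at x) v + frechet_derivative f (at x) v * g x)"
      using Suc Suc.prems[THEN Ck_on_Suc_imp] by (intro Ck_on_add assms(1) Suc.IH) auto
    show "f x * frechet_derivative g (at x) v + frechet_derivative f (at x) v * g x
        = frechet_derivative (\<lambda>x. f x * g x) (at x) v" if "x \<in> S" for x
      using frechet_derivative_at[OF has_derivative_mult[of f "frechet_derivative f (at x)" x UNIV g
          "frechet_derivative g (at x)"]] Suc.prems that
      by (simp add: frechet_derivative_works[symmetric] fun_eq_iff)
  qed
  then show ?case using Suc.prems by auto
qed

text \<open>The derivative of \<open>1/f\<close> is built from \<open>1/f\<close> and the derivative
  of \<open>f\<close>; the induction hypothesis supplies class \<open>k\<close> for the first of
  these.\<close>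

lemma Ck_on_inverse:
  fixes f :: "'a::euclidean_space \<Rightarrow> real"
  assumes "open S" "Ck_on k S f" "\<And>x. x \<in> S \<Longrightarrow> f x \<noteq> 0"
  shows "Ck_on k S (\<lambda>x. inverse (f x))"
  using assms(2)
proof (induction k)
  case 0
  then show ?case using assms(3) by (auto intro: continuous_on_inverse)
next
  case (Suc k)
  have inv: "Ck_on k S (\<lambda>x. inverse (f x))"
    using Suc Ck_on_Suc_imp by blast
  have "Ck_on k S (\<lambda>x. frechet_derivative (\<lambda>x. inverse (f x)) (at x) v)" for v
  proof (rule Ck_on_cong[OF assms(1)])
    show "Ck_on k S (\<lambda>x. (-1) * (inverse (f x) * frechet_derivative f (at x) v * inverse (f x)))"
      using Suc inv by (intro Ck_on_mult Ck_on_const assms(1)) auto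
    show "(-1) * (inverse (f x) * frechet_derivative f (at x) v * inverse (f x))
        = frechet_derivative (\<lambda>x. inverse (f x)) (at x) v" if "x \<in> S" for x
    proof -
      have "((\<lambda>x. inverse (f x)) has_derivative
          (\<lambda>h. - (inverse (f x) * frechet_derivative f (at x) h * inverse (f x)))) (at x)"
        using Suc.prems that assms(3)
        by (intro Deriv.has_derivative_inverse) (auto simp: frechet_derivative_works[symmetric])
      from frechet_derivative_at[OF this] show ?thesis by (simp add: fun_eq_iff)
    qed
  qed
  then show ?case using Suc.prems assms(3) by auto
qed

lemma smooth_on_cong:
  "open S \<Longrightarrow> smooth_on S f \<Longrightarrow> (\<And>x. x \<in> S \<Longrightarrow> f x = g x) \<Longrightarrow> smooth_on S g"
  unfolding smooth_on_def using Ck_on_cong by blast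

lemma smooth_on_const: "smooth_on S (\<lambda>x. c)"
  unfolding smooth_on_def using Ck_on_const by blast

lemma smooth_on_linear: "bounded_linear f \<Longrightarrow> smooth_on S f"
  unfolding smooth_on_def using Ck_on_linear by blast

lemma smooth_on_add:
  "open S \<Longrightarrow> smooth_on S f \<Longrightarrow> smooth_on S g \<Longrightarrow> smooth_on S (\<lambda>x. f x + g x)"
  unfolding smooth_on_def using Ck_on_add by blast

lemma smooth_on_mult:
  fixes f g :: "'a::euclidean_space \<Rightarrow> real"
  shows "open S \<Longrightarrow> smooth_on S f \<Longrightarrow> smooth_on S g \<Longrightarrow> smooth_on S (\<lambda>x. f x * g x)"
  unfolding smooth_on_def using Ck_on_mult by blast

lemma smooth_on_inverse:
  fixes f :: "'a::euclidean_space \<Rightarrow> real"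
  shows "open S \<Longrightarrow> smooth_on S f \<Longrightarrow> (\<And>x. x \<in> S \<Longrightarrow> f x \<noteq> 0) \<Longrightarrow> smooth_on S (\<lambda>x. inverse (f x))"
  unfolding smooth_on_def using Ck_on_inverse by blast

lemma smooth_on_sum:
  assumes "open S" "\<And>i. i \<in> I \<Longrightarrow> smooth_on S (f i)"
  shows "smooth_on S (\<lambda>x. \<Sum>i\<in>I. f i x)"
  using assms(2)
  by (induction I rule: infinite_finite_induct) (auto intro: smooth_on_const smooth_on_add assms(1))

lemma smooth_on_prod:
  fixes f :: "'i \<Rightarrow> 'a::euclidean_space \<Rightarrow> real"
  assumes "open S" "\<And>i. i \<in> I \<Longrightarrow> smooth_on S (f i)"
  shows "smooth_on S (\<lambda>x. \<Prod>i\<in>I. f i x)"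
  using assms(2)
  by (induction I rule: infinite_finite_induct) (auto intro: smooth_on_const smooth_on_mult assms(1))

lemma smooth_on_imp_differentiable:
  assumes "smooth_on S f" "x \<in> S"
  shows "f differentiable at x"
proof -
  have "Ck_on (Suc 0) S f" using assms(1) unfolding smooth_on_def by blast
  then show ?thesis using assms(2) by simp
qed

lemma smooth_on_imp_continuous_on: "smooth_on S f \<Longrightarrow> continuous_on S f"
  using Ck_on.simps(1) unfolding smooth_on_def by blast

lemma smooth_on_frechet_derivative:
  assumes "smooth_on S f"
  shows "smooth_on S (\<lambda>x. frechet_derivative f (at x) v)"
  unfolding smooth_on_def
proof
  fix k
  have "Ck_on (Suc k) S f" using assms unfolding smooth_on_def by blast
  then show "Ck_on k S (\<lambda>x. frechet_derivative f (at x) v)" by simp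
qed

section \<open>Derivatives along lines and the symmetry of second derivatives\<close>

lemma DERIV_along_line:
  fixes f :: "'a::euclidean_space \<Rightarrow> real"
  assumes "f differentiable at (a + t *\<^sub>R u)"
  shows "((\<lambda>s. f (a + s *\<^sub>R u)) has_real_derivative frechet_derivative f (at (a + t *\<^sub>R u)) u) (at t)"
proof -
  have lin: "((\<lambda>s. a + s *\<^sub>R u) has_derivative (\<lambda>s. s *\<^sub>R u)) (at t)"
    by (auto intro!: derivative_eq_intros)
  have "((\<lambda>s. f (a + s *\<^sub>R u)) has_derivative
      (\<lambda>s. frechet_derivative f (at (a + t *\<^sub>R u)) (s *\<^sub>R u))) (at t)"
    using diff_chain_at[OF lin] assms frechet_derivative_works by (force simp: o_def)
  moreover have "frechet_derivative f (at (a + t *\<^sub>R u)) (s *\<^sub>R u)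
      = s * frechet_derivative f (at (a + t *\<^sub>R u)) u" for s
    using linear_frechet_derivative[OF assms] by (simp add: linear_cmul)
  ultimately show ?thesis
    by (simp add: has_field_derivative_def mult_commute_abs)
qed

text \<open>Both mixed derivatives are limits of the same second difference quotient.\<close>

lemma second_difference_quotient:
  fixes f :: "'a::euclidean_space \<Rightarrow> real"
  assumes S: "open S" "a \<in> S" and sm: "smooth_on S f" and e: "e > 0"
  defines "D \<equiv> \<lambda>w z. frechet_derivative f (at z) w"
  shows "\<exists>d>0. \<forall>h. 0 < h \<and> h < d \<longrightarrow>
     \<bar>(f (a + h *\<^sub>R u + h *\<^sub>R v) - f (a + h *\<^sub>R u) - f (a + h *\<^sub>R v) + f a) / h\<^sup>2
       - frechet_derivative (D u) (at a) v\<bar> < e"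
proof -
  let ?DD = "\<lambda>z. frechet_derivative (D u) (at z) v"
  have smD: "smooth_on S (D u)"
    unfolding D_def by (rule smooth_on_frechet_derivative[OF sm])
  have "continuous_on S ?DD"
    by (intro smooth_on_imp_continuous_on smooth_on_frechet_derivative smD)
  then have "isCont ?DD a" using S continuous_on_eq_continuous_at by blast
  then obtain r where r: "r > 0" "\<And>z. dist z a < r \<Longrightarrow> dist (?DD z) (?DD a) < e"
    using e unfolding continuous_at_eps_delta by metis
  obtain r' where r': "r' > 0" "ball a r' \<subseteq> S" using S open_contains_ball by blast
  define q where "q = min r r'"
  \<comment> \<open>For \<open>h < d\<close> the parallelogram with sides \<open>h u\<close> and
    \<open>h v\<close> at \<open>a\<close> stays within distance \<open>q\<close>; the summand 1
    keeps the denominator positive when \<open>u = v = 0\<close>.\<close>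
  define d where "d = q / (norm u + norm v + 1)"
  have pos: "norm u + norm v + 1 > 0" by (smt (verit) norm_ge_zero)
  have q: "q > 0" using r r' by (simp add: q_def)
  have d: "d > 0" using q pos by (simp add: d_def)
  have near: "dist (a + s *\<^sub>R u + t *\<^sub>R v) a < q"
    if "0 \<le> s" "s \<le> h" "0 \<le> t" "t \<le> h" "h < d" for s t h
  proof -
    have "dist (a + s *\<^sub>R u + t *\<^sub>R v) a = norm (s *\<^sub>R u + t *\<^sub>R v)"
      by (simp add: dist_norm algebra_simps)
    also have "\<dots> \<le> norm (s *\<^sub>R u) + norm (t *\<^sub>R v)" by (rule norm_triangle_ineq)
    also have "\<dots> \<le> h * norm u + h * norm v"
      using that by (auto intro!: add_mono mult_right_mono)
    also have "\<dots> \<le> h * (norm u + norm v + 1)" using that by (simp add: algebra_simps)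
    also have "\<dots> < d * (norm u + norm v + 1)" using that pos by simp
    also have "\<dots> = q" using pos by (simp add: d_def)
    finally show ?thesis .
  qed
  have inS: "z \<in> S" if "dist z a < q" for z
    using that r' by (auto simp: q_def dist_commute subset_iff)
  show ?thesis
  proof (intro exI[of _ d] conjI allI impI d)
    fix h :: real assume "0 < h \<and> h < d"
    then have h: "0 < h" "h < d" by auto
    \<comment> \<open>The second difference is the increment of \<open>?g\<close> over
      \<open>[0, h]\<close>. The mean value theorem, first in direction \<open>u\<close> and then in
      direction \<open>v\<close>, turns it into a mixed derivative at one point of the
      parallelogram.\<close>
    let ?g = "\<lambda>s. f (a + s *\<^sub>R u + h *\<^sub>R v) - f (a + s *\<^sub>R u)"
    let ?g' = "\<lambda>s. D u (a + s *\<^sub>R u + h *\<^sub>R v) - D u (a + s *\<^sub>R u)"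
    have "(?g has_real_derivative ?g' s) (at s)" if "0 \<le> s" "s \<le> h" for s
    proof (rule DERIV_diff)
      have "a + h *\<^sub>R v + s *\<^sub>R u \<in> S" "a + s *\<^sub>R u \<in> S"
        using inS near[of s h h] near[of s h 0] that h by (auto simp: add_ac)
      from DERIV_along_line[OF smooth_on_imp_differentiable[OF sm this(1)]]
        DERIV_along_line[OF smooth_on_imp_differentiable[OF sm this(2)]]
      show "((\<lambda>s. f (a + s *\<^sub>R u + h *\<^sub>R v)) has_real_derivative D u (a + s *\<^sub>R u + h *\<^sub>R v)) (at s)"
        "((\<lambda>s. f (a + s *\<^sub>R u)) has_real_derivative D u (a + s *\<^sub>R u)) (at s)"
        by (simp_all add: D_def add_ac)
    qed
    from MVT2[OF h(1) this] obtain s where s: "0 < s" "s < h" "?g h - ?g 0 = h * ?g' s"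
      by auto
    let ?k = "\<lambda>t. D u (a + s *\<^sub>R u + t *\<^sub>R v)"
    have "(?k has_real_derivative ?DD (a + s *\<^sub>R u + t *\<^sub>R v)) (at t)" if "0 \<le> t" "t \<le> h" for t
      using DERIV_along_line[OF smooth_on_imp_differentiable[OF smD inS[OF near[of s h t]]]]
        that h s by simp
    from MVT2[OF h(1) this] obtain t where t: "0 < t" "t < h"
      "?k h - ?k 0 = h * ?DD (a + s *\<^sub>R u + t *\<^sub>R v)" by auto
    have "f (a + h *\<^sub>R u + h *\<^sub>R v) - f (a + h *\<^sub>R u) - f (a + h *\<^sub>R v) + f a = ?g h - ?g 0"
      by simp
    also have "\<dots> = h\<^sup>2 * ?DD (a + s *\<^sub>R u + t *\<^sub>R v)"
      using s(3) t(3) by (simp add: power2_eq_square)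
    finally have "(f (a + h *\<^sub>R u + h *\<^sub>R v) - f (a + h *\<^sub>R u) - f (a + h *\<^sub>R v) + f a) / h\<^sup>2
        = ?DD (a + s *\<^sub>R u + t *\<^sub>R v)" using h by simp
    moreover have "dist (a + s *\<^sub>R u + t *\<^sub>R v) a < r"
      using near[of s h t] s t h by (simp add: q_def)
    ultimately show "\<bar>(f (a + h *\<^sub>R u + h *\<^sub>R v) - f (a + h *\<^sub>R u) - f (a + h *\<^sub>R v) + f a) / h\<^sup>2
       - ?DD a\<bar> < e"
      using r(2) by (simp add: dist_real_def)
  qed
qed

lemma smooth_on_mixed_derivatives:
  fixes f :: "'a::euclidean_space \<Rightarrow> real"
  assumes "open S" "a \<in> S" "smooth_on S f"
  shows "frechet_derivative (\<lambda>z. frechet_derivative f (at z) u) (at a) v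
       = frechet_derivative (\<lambda>z. frechet_derivative f (at z) v) (at a) u" (is "?A = ?B")
proof (rule ccontr)
  assume "?A \<noteq> ?B"
  then have e: "\<bar>?A - ?B\<bar> / 2 > 0" by simp
  obtain d1 where d1: "d1 > 0" "\<And>h. 0 < h \<Longrightarrow> h < d1 \<Longrightarrow>
     \<bar>(f (a + h *\<^sub>R u + h *\<^sub>R v) - f (a + h *\<^sub>R u) - f (a + h *\<^sub>R v) + f a) / h\<^sup>2 - ?A\<bar> < \<bar>?A - ?B\<bar> / 2"
    using second_difference_quotient[OF assms e, of u v] by auto
  obtain d2 where d2: "d2 > 0" "\<And>h. 0 < h \<Longrightarrow> h < d2 \<Longrightarrow>
     \<bar>(f (a + h *\<^sub>R v + h *\<^sub>R u) - f (a + h *\<^sub>R v) - f (a + h *\<^sub>R u) + f a) / h\<^sup>2 - ?B\<bar> < \<bar>?A - ?B\<bar> / 2"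
    using second_difference_quotient[OF assms e, of v u] by auto
  define h where "h = min d1 d2 / 2"
  have h: "0 < h" "h < d1" "h < d2" using d1(1) d2(1) by (auto simp: h_def)
  \<comment> \<open>The second difference is symmetric in \<open>u\<close> and \<open>v\<close>, so
    a single quotient would lie within half the gap of both mixed derivatives.\<close>
  have "f (a + h *\<^sub>R v + h *\<^sub>R u) - f (a + h *\<^sub>R v) - f (a + h *\<^sub>R u) + f a
      = f (a + h *\<^sub>R u + h *\<^sub>R v) - f (a + h *\<^sub>R u) - f (a + h *\<^sub>R v) + f a"
    by (simp add: add_ac)
  then obtain q where "\<bar>q - ?A\<bar> < \<bar>?A - ?B\<bar> / 2" "\<bar>q - ?B\<bar> < \<bar>?A - ?B\<bar> / 2"
    using d1(2)[OF h(1,2)] d2(2)[OF h(1,3)] by metis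
  then show False by (simp add: abs_if split: if_splits)
qed

section \<open>Calculus on the slit tangent bundle of a coordinate domain\<close>

text \<open>A directional derivative in the product space, so that \<open>dx\<close> and
  \<open>dy\<close> become instances of one operator and each rule of calculus is proved once for
  both.\<close>

definition pd :: "(real ^ 'n) \<times> (real ^ 'n) \<Rightarrow> (real ^ 'n::finite \<Rightarrow> real ^ 'n \<Rightarrow> real) \<Rightarrow>
    real ^ 'n \<Rightarrow> real ^ 'n \<Rightarrow> real" where
  "pd v f x y = deriv (\<lambda>t. f (x + t *\<^sub>R fst v) (y + t *\<^sub>R snd v)) 0"

lemma dx_pd: "dx i = pd (axis i 1, 0)" and dy_pd: "dy i = pd (0, axis i 1)"
  by (simp_all add: dx_def dy_def pd_def fun_eq_iff)

text \<open>The vector field \<open>y^m d/dx^m - 2 G^r d/dy^r\<close> applied to a function. For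
  \<open>G\<close> of degree two it is the contraction of the horizontal derivatives with
  \<open>y\<close>.\<close>

definition spray_deriv :: "('n::finite \<Rightarrow> real ^ 'n \<Rightarrow> real ^ 'n \<Rightarrow> real) \<Rightarrow>
    (real ^ 'n \<Rightarrow> real ^ 'n \<Rightarrow> real) \<Rightarrow> real ^ 'n \<Rightarrow> real ^ 'n \<Rightarrow> real" where
  "spray_deriv G f x y =
     (\<Sum>m\<in>UNIV. y $ m * dx m f x y) - 2 * (\<Sum>r\<in>UNIV. G r x y * dy r f x y)"

definition euler_op ::
    "(real ^ 'n::finite \<Rightarrow> real ^ 'n \<Rightarrow> real) \<Rightarrow> real ^ 'n \<Rightarrow> real ^ 'n \<Rightarrow> real" where
  "euler_op f x y = (\<Sum>r\<in>UNIV. y $ r * dy r f x y)"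

lemma sum_axis:
  fixes f :: "'n::finite \<Rightarrow> real"
  shows "(\<Sum>m\<in>UNIV. axis k 1 $ m * f m) = f k" "(\<Sum>m\<in>UNIV. f m * axis k 1 $ m) = f k"
    "(\<Sum>m\<in>UNIV. axis m 1 $ k * f m) = f k" "(\<Sum>m\<in>UNIV. f m * axis m 1 $ k) = f k"
  by (simp_all add: axis_def if_distrib[of "\<lambda>a. a * _"] if_distrib[of "\<lambda>a. _ * a"] cong: if_cong)

locale slit_chart =
  fixes U :: "(real ^ 'n::finite) set"
  assumes open_U: "open U"
begin

definition sm :: "(real ^ 'n \<Rightarrow> real ^ 'n \<Rightarrow> real) \<Rightarrow> bool" where
  "sm f \<longleftrightarrow> smooth_on (U \<times> - {0}) (\<lambda>(x, y). f x y)"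

text \<open>Homogeneity is encoded by Euler's equation, which can be differentiated directly. The
  degree is real because the Berwald curvature has degree -1.\<close>

definition homog :: "real \<Rightarrow> (real ^ 'n \<Rightarrow> real ^ 'n \<Rightarrow> real) \<Rightarrow> bool" where
  "homog h f \<longleftrightarrow> (\<forall>x\<in>U. \<forall>y. y \<noteq> 0 \<longrightarrow> euler_op f x y = h * f x y)"

lemma open_slit: "open (U \<times> (- {0} :: (real ^ 'n) set))"
  by (intro open_Times open_U open_Compl closed_singleton)

lemma sm_cong:
  "sm f \<Longrightarrow> (\<And>x y. x \<in> U \<Longrightarrow> y \<noteq> 0 \<Longrightarrow> f x y = g x y) \<Longrightarrow> sm g"
  unfolding sm_def by (erule smooth_on_cong[OF open_slit]) auto

lemma sm_const [simp, intro]: "sm (\<lambda>x y. c)"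
  using smooth_on_const by (simp add: sm_def split_def)

lemma sm_coord [simp, intro]: "sm (\<lambda>x y. y $ i)"
  unfolding sm_def split_def
  by (intro smooth_on_linear bounded_linear_compose[OF bounded_linear_vec_nth bounded_linear_snd])

lemma sm_add [simp, intro]: "sm f \<Longrightarrow> sm g \<Longrightarrow> sm (\<lambda>x y. f x y + g x y)"
  using smooth_on_add[OF open_slit] by (simp add: sm_def split_def)

lemma sm_mult [simp, intro]: "sm f \<Longrightarrow> sm g \<Longrightarrow> sm (\<lambda>x y. f x y * g x y)"
  using smooth_on_mult[OF open_slit] by (simp add: sm_def split_def)

lemma sm_diff [simp, intro]: "sm f \<Longrightarrow> sm g \<Longrightarrow> sm (\<lambda>x y. f x y - g x y)"
  using sm_add[OF _ sm_mult[OF sm_const[of "-1"]], of f g] by simp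

lemma sm_sum [simp, intro]: "(\<And>i. i \<in> I \<Longrightarrow> sm (f i)) \<Longrightarrow> sm (\<lambda>x y. \<Sum>i\<in>I. f i x y)"
  unfolding sm_def split_def by (rule smooth_on_sum[OF open_slit])

lemma sm_prod [simp, intro]: "(\<And>i. i \<in> I \<Longrightarrow> sm (f i)) \<Longrightarrow> sm (\<lambda>x y. \<Prod>i\<in>I. f i x y)"
  unfolding sm_def split_def by (rule smooth_on_prod[OF open_slit])

lemma sm_divide:
  assumes "sm f" "sm g" "\<And>x y. x \<in> U \<Longrightarrow> y \<noteq> 0 \<Longrightarrow> g x y \<noteq> 0"
  shows "sm (\<lambda>x y. f x y / g x y)"
proof -
  have "sm (\<lambda>x y. inverse (g x y))"
    using assms(2,3) unfolding sm_def split_def by (intro smooth_on_inverse[OF open_slit]) auto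
  then show ?thesis using sm_mult[OF assms(1)] by (simp add: divide_inverse)
qed

lemma sm_divide_const [simp, intro]: "sm f \<Longrightarrow> sm (\<lambda>x y. f x y / c)"
  using sm_mult[OF _ sm_const[of "inverse c"]] by (simp add: divide_inverse)

lemma sm_det:
  assumes "\<And>i j. sm (a i j)" shows "sm (\<lambda>x y. det (\<chi> i j. a i j x y))"
  unfolding det_def using assms by simp

lemma sm_differentiable:
  "sm f \<Longrightarrow> x \<in> U \<Longrightarrow> y \<noteq> 0 \<Longrightarrow> (\<lambda>z. f (fst z) (snd z)) differentiable at (x, y)"
  using smooth_on_imp_differentiable[of "U \<times> - {0}" "\<lambda>(x, y). f x y" "(x, y)"]
  by (simp add: sm_def split_def)

lemma pd_DERIV:
  assumes "sm f" "x \<in> U" "y \<noteq> 0"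
  shows "((\<lambda>t. f (x + t *\<^sub>R fst v) (y + t *\<^sub>R snd v)) has_real_derivative
      frechet_derivative (\<lambda>z. f (fst z) (snd z)) (at (x, y)) v) (at 0)"
  using DERIV_along_line[of "\<lambda>z. f (fst z) (snd z)" "(x, y)" 0 v] sm_differentiable[OF assms]
  by simp

lemma pd_eq_frechet:
  assumes "sm f" "x \<in> U" "y \<noteq> 0"
  shows "pd v f x y = frechet_derivative (\<lambda>z. f (fst z) (snd z)) (at (x, y)) v"
  unfolding pd_def by (rule DERIV_imp_deriv[OF pd_DERIV[OF assms]])

lemma pd_has_deriv:
  assumes "sm f" "x \<in> U" "y \<noteq> 0"
  shows "((\<lambda>t. f (x + t *\<^sub>R fst v) (y + t *\<^sub>R snd v)) has_real_derivative pd v f x y) (at 0)"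
  using pd_DERIV[OF assms] pd_eq_frechet[OF assms] by simp

lemma pd_eq_frechet_pair:
  "sm f \<Longrightarrow> z \<in> U \<times> - {0} \<Longrightarrow>
    frechet_derivative (\<lambda>z. f (fst z) (snd z)) (at z) v = pd v f (fst z) (snd z)"
  by (cases z) (simp add: pd_eq_frechet)

lemma sm_pd: assumes "sm f" shows "sm (pd v f)"
  unfolding sm_def
proof (rule smooth_on_cong[OF open_slit])
  show "smooth_on (U \<times> - {0}) (\<lambda>w. frechet_derivative (\<lambda>z. f (fst z) (snd z)) (at w) v)"
    using assms by (intro smooth_on_frechet_derivative) (simp add: sm_def split_def)
qed (simp add: pd_eq_frechet_pair assms split_def)

text \<open>The slit domain is open, so a short piece of the line through \<open>(x, y)\<close>
  stays where \<open>f\<close> and \<open>g\<close> agree.\<close>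

lemma pd_cong:
  assumes "\<And>x y. x \<in> U \<Longrightarrow> y \<noteq> 0 \<Longrightarrow> f x y = g x y" "x \<in> U" "y \<noteq> 0"
  shows "pd v f x y = pd v g x y"
  unfolding pd_def
proof (rule deriv_cong_ev)
  let ?p = "\<lambda>t::real. (x + t *\<^sub>R fst v, y + t *\<^sub>R snd v)"
  have "(?p \<longlongrightarrow> ?p 0) (nhds 0)"
    by (intro tendsto_intros tendsto_ident_at filterlim_ident)
  then have "\<forall>\<^sub>F t in nhds 0. ?p t \<in> U \<times> - {0}"
    using assms(2,3) by (intro topological_tendstoD[OF _ open_slit]) auto
  then show "\<forall>\<^sub>F t in nhds 0. f (x + t *\<^sub>R fst v) (y + t *\<^sub>R snd v)
      = g (x + t *\<^sub>R fst v) (y + t *\<^sub>R snd v)"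
    by eventually_elim (use assms(1) in auto)
qed simp

lemma pd_const: "pd v (\<lambda>x y. c) x y = 0"
  by (simp add: pd_def)

lemma pd_coord: "pd v (\<lambda>x y. y $ i) x y = snd v $ i"
  unfolding pd_def by (rule DERIV_imp_deriv) (auto intro!: derivative_eq_intros)

lemma pd_add:
  "sm f \<Longrightarrow> sm g \<Longrightarrow> x \<in> U \<Longrightarrow> y \<noteq> 0 \<Longrightarrow>
    pd v (\<lambda>x y. f x y + g x y) x y = pd v f x y + pd v g x y"
  unfolding pd_def[of v "\<lambda>x y. f x y + g x y"]
  by (rule DERIV_imp_deriv) (auto intro!: derivative_eq_intros pd_has_deriv)

lemma pd_diff:
  "sm f \<Longrightarrow> sm g \<Longrightarrow> x \<in> U \<Longrightarrow> y \<noteq> 0 \<Longrightarrow>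
    pd v (\<lambda>x y. f x y - g x y) x y = pd v f x y - pd v g x y"
  unfolding pd_def[of v "\<lambda>x y. f x y - g x y"]
  by (rule DERIV_imp_deriv) (auto intro!: derivative_eq_intros pd_has_deriv)

lemma pd_mult:
  assumes "sm f" "sm g" "x \<in> U" "y \<noteq> 0"
  shows "pd v (\<lambda>x y. f x y * g x y) x y = pd v f x y * g x y + f x y * pd v g x y"
  unfolding pd_def[of v "\<lambda>x y. f x y * g x y"]
  using DERIV_mult[OF pd_has_deriv[OF assms(1,3,4)] pd_has_deriv[OF assms(2-4)]]
  by (intro DERIV_imp_deriv) (simp add: mult.commute)

lemma pd_sum:
  assumes "\<And>i. i \<in> I \<Longrightarrow> sm (f i)" "x \<in> U" "y \<noteq> 0"
  shows "pd v (\<lambda>x y. \<Sum>i\<in>I. f i x y) x y = (\<Sum>i\<in>I. pd v (f i) x y)"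
  unfolding pd_def[of v "\<lambda>x y. \<Sum>i\<in>I. f i x y"]
  by (intro DERIV_imp_deriv DERIV_sum pd_has_deriv assms)

lemma pd_commute:
  assumes "sm f" "x \<in> U" "y \<noteq> 0"
  shows "pd v (pd w f) x y = pd w (pd v f) x y"
proof -
  let ?f = "\<lambda>z. f (fst z) (snd z)"
  have "pd v (pd w f) x y = frechet_derivative (\<lambda>z. frechet_derivative ?f (at z) w) (at (x, y)) v"
    for v w
  proof -
    have "frechet_derivative (\<lambda>z. pd w f (fst z) (snd z)) (at (x, y))
        = frechet_derivative (\<lambda>z. frechet_derivative ?f (at z) w) (at (x, y))"
      by (rule frechet_derivative_transform_within_open[OF _ open_slit])
        (simp_all add: assms sm_differentiable[OF sm_pd] pd_eq_frechet_pair)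
    then show ?thesis
      using pd_eq_frechet[OF sm_pd, OF assms] by simp
  qed
  moreover have "smooth_on (U \<times> - {0}) ?f" using assms by (simp add: sm_def split_def)
  ultimately show ?thesis
    using smooth_on_mixed_derivatives[OF open_slit _, of "(x, y)" ?f v w] assms by simp
qed

lemma sm_dx [simp, intro]: "sm f \<Longrightarrow> sm (dx i f)"
  and sm_dy [simp, intro]: "sm f \<Longrightarrow> sm (dy i f)"
  by (simp_all add: dx_pd dy_pd sm_pd)

lemmas dx_cong = pd_cong[of _ _ _ _ "(axis i 1, 0)" for i, folded dx_pd]
lemmas dy_cong = pd_cong[of _ _ _ _ "(0, axis i 1)" for i, folded dy_pd]

lemmas d_rules =
  pd_const[of "(axis i 1, 0)" for i, folded dx_pd] pd_const[of "(0, axis i 1)" for i, folded dy_pd]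
  pd_coord[of "(axis i 1, 0)" for i, folded dx_pd, simplified]
  pd_coord[of "(0, axis i 1)" for i, folded dy_pd, simplified]
  pd_add[of _ _ _ _ "(axis i 1, 0)" for i, folded dx_pd]
  pd_add[of _ _ _ _ "(0, axis i 1)" for i, folded dy_pd]
  pd_diff[of _ _ _ _ "(axis i 1, 0)" for i, folded dx_pd]
  pd_diff[of _ _ _ _ "(0, axis i 1)" for i, folded dy_pd]
  pd_mult[of _ _ _ _ "(axis i 1, 0)" for i, folded dx_pd]
  pd_mult[of _ _ _ _ "(0, axis i 1)" for i, folded dy_pd]
  pd_sum[of _ _ _ _ "(axis i 1, 0)" for i, folded dx_pd]
  pd_sum[of _ _ _ _ "(0, axis i 1)" for i, folded dy_pd]

lemmas dy_dx = pd_commute[of _ _ _ "(0, axis i 1)" "(axis j 1, 0)" for i j, folded dx_pd dy_pd]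
lemmas dy_dy = pd_commute[of _ _ _ "(0, axis i 1)" "(0, axis j 1)" for i j, folded dx_pd dy_pd]

section \<open>The spray as a derivation on functions\<close>

lemma spray_deriv_cong:
  assumes "\<And>x y. x \<in> U \<Longrightarrow> y \<noteq> 0 \<Longrightarrow> f x y = g x y" "x \<in> U" "y \<noteq> 0"
  shows "spray_deriv G f x y = spray_deriv G g x y"
  unfolding spray_deriv_def using dx_cong[OF assms] dy_cong[OF assms] by simp

lemma spray_deriv_const: "spray_deriv G (\<lambda>x y. c) x y = 0"
  by (simp add: spray_deriv_def d_rules)

lemma spray_deriv_coord: "spray_deriv G (\<lambda>x y. y $ i) x y = - 2 * G i x y"
  by (simp add: spray_deriv_def d_rules sum_axis)

lemma spray_deriv_add:
  "sm f \<Longrightarrow> sm g \<Longrightarrow> x \<in> U \<Longrightarrow> y \<noteq> 0 \<Longrightarrow>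
    spray_deriv G (\<lambda>x y. f x y + g x y) x y = spray_deriv G f x y + spray_deriv G g x y"
  by (simp add: spray_deriv_def d_rules algebra_simps sum.distrib)

lemma spray_deriv_diff:
  "sm f \<Longrightarrow> sm g \<Longrightarrow> x \<in> U \<Longrightarrow> y \<noteq> 0 \<Longrightarrow>
    spray_deriv G (\<lambda>x y. f x y - g x y) x y = spray_deriv G f x y - spray_deriv G g x y"
  by (simp add: spray_deriv_def d_rules algebra_simps sum_subtractf)

lemma spray_deriv_mult:
  "sm f \<Longrightarrow> sm g \<Longrightarrow> x \<in> U \<Longrightarrow> y \<noteq> 0 \<Longrightarrow>
    spray_deriv G (\<lambda>x y. f x y * g x y) x y
      = spray_deriv G f x y * g x y + f x y * spray_deriv G g x y"
  by (simp add: spray_deriv_def d_rules algebra_simps sum.distrib sum_distrib_left)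

lemma spray_deriv_sum:
  assumes "\<And>i. i \<in> I \<Longrightarrow> sm (f i)" "x \<in> U" "y \<noteq> 0"
  shows "spray_deriv G (\<lambda>x y. \<Sum>i\<in>I. f i x y) x y = (\<Sum>i\<in>I. spray_deriv G (f i) x y)"
  using assms(1)
proof (induction I rule: infinite_finite_induct)
  case (insert a I)
  then show ?case
    using spray_deriv_add[of "f a" "\<lambda>x y. \<Sum>i\<in>I. f i x y"] assms(2,3) by simp
qed (simp_all add: spray_deriv_const)

text \<open>The commutator of the spray with a vertical derivative: differentiating the coefficient
  \<open>y^m\<close> leaves \<open>dx k f\<close>, and differentiating \<open>G^r\<close> leaves the
  last sum.\<close>

lemma dy_spray_deriv:
  assumes G: "\<And>i. sm (G i)" and "sm f" "x \<in> U" "y \<noteq> 0"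
  shows "dy k (spray_deriv G f) x y
    = dx k f x y + spray_deriv G (dy k f) x y - 2 * (\<Sum>r\<in>UNIV. dy k (G r) x y * dy r f x y)"
proof -
  have "dy k (spray_deriv G f) x y = dy k (\<lambda>x y.
     (\<Sum>m\<in>UNIV. y $ m * dx m f x y) - 2 * (\<Sum>r\<in>UNIV. G r x y * dy r f x y)) x y"
    by (rule arg_cong[of _ _ "\<lambda>h. dy k h x y"]) (simp add: spray_deriv_def fun_eq_iff)
  also have "\<dots> = (\<Sum>m\<in>UNIV. axis k 1 $ m * dx m f x y + y $ m * dx m (dy k f) x y)
      - 2 * (\<Sum>r\<in>UNIV. dy k (G r) x y * dy r f x y + G r x y * dy r (dy k f) x y)"
    using assms by (simp add: d_rules dy_dx[of f] dy_dy[of f _ _ k])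
  finally show ?thesis
    by (simp add: spray_deriv_def sum.distrib sum_axis algebra_simps)
qed

section \<open>Homogeneity through Euler's equation\<close>

lemma euler_op_cong:
  assumes "\<And>x y. x \<in> U \<Longrightarrow> y \<noteq> 0 \<Longrightarrow> f x y = g x y" "x \<in> U" "y \<noteq> 0"
  shows "euler_op f x y = euler_op g x y"
  unfolding euler_op_def using dy_cong[OF assms] by simp

lemma homogD: "homog h f \<Longrightarrow> x \<in> U \<Longrightarrow> y \<noteq> 0 \<Longrightarrow> (\<Sum>r\<in>UNIV. y $ r * dy r f x y) = h * f x y"
  by (simp add: homog_def euler_op_def)

lemma homog_coord: "homog 1 (\<lambda>x y. y $ i)"
  by (simp add: homog_def euler_op_def d_rules sum_axis)

lemma homog_add: "sm f \<Longrightarrow> sm g \<Longrightarrow> homog h f \<Longrightarrow> homog h g \<Longrightarrow> homog h (\<lambda>x y. f x y + g x y)"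
  by (simp add: homog_def euler_op_def d_rules sum.distrib algebra_simps)

lemma homog_diff: "sm f \<Longrightarrow> sm g \<Longrightarrow> homog h f \<Longrightarrow> homog h g \<Longrightarrow> homog h (\<lambda>x y. f x y - g x y)"
  by (simp add: homog_def euler_op_def d_rules sum_subtractf algebra_simps)

lemma homog_mult:
  "sm f \<Longrightarrow> sm g \<Longrightarrow> homog h f \<Longrightarrow> homog h' g \<Longrightarrow> h'' = h + h' \<Longrightarrow>
    homog h'' (\<lambda>x y. f x y * g x y)"
  unfolding homog_def euler_op_def
proof (intro ballI allI impI)
  fix x y
  assume *: "sm f" "sm g" "h'' = h + h'" "x \<in> U" "y \<noteq> (0 :: real ^ 'n)"
    "\<forall>x\<in>U. \<forall>y. y \<noteq> 0 \<longrightarrow> (\<Sum>r\<in>UNIV. y $ r * dy r f x y) = h * f x y"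
    "\<forall>x\<in>U. \<forall>y. y \<noteq> 0 \<longrightarrow> (\<Sum>r\<in>UNIV. y $ r * dy r g x y) = h' * g x y"
  have "(\<Sum>r\<in>UNIV. y $ r * dy r (\<lambda>x y. f x y * g x y) x y)
     = (\<Sum>r\<in>UNIV. y $ r * dy r f x y) * g x y + f x y * (\<Sum>r\<in>UNIV. y $ r * dy r g x y)"
    using *(1,2,4,5) by (simp add: d_rules sum.distrib algebra_simps sum_distrib_left)
  then show "(\<Sum>r\<in>UNIV. y $ r * dy r (\<lambda>x y. f x y * g x y) x y) = h'' * (f x y * g x y)"
    using * by (simp add: algebra_simps)
qed

lemma homog_sum:
  assumes "\<And>i. i \<in> I \<Longrightarrow> sm (f i)" "\<And>i. i \<in> I \<Longrightarrow> homog h (f i)"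
  shows "homog h (\<lambda>x y. \<Sum>i\<in>I. f i x y)"
  using assms
proof (induction I rule: infinite_finite_induct)
  case (insert a I)
  then show ?case by (simp add: homog_add)
qed (simp_all add: homog_def euler_op_def d_rules)

text \<open>Differentiating Euler's equation in \<open>y^j\<close> produces one extra copy of
  \<open>dy j f\<close> from the coefficient \<open>y^j\<close>, which lowers the degree by
  one.\<close>

lemma homog_dy:
  assumes "sm f" "homog h f" "h' = h - 1" shows "homog h' (dy j f)"
  unfolding homog_def
proof (intro ballI allI impI)
  fix x y assume xy: "x \<in> U" "y \<noteq> (0 :: real ^ 'n)"
  have "dy j (\<lambda>x y. \<Sum>r\<in>UNIV. y $ r * dy r f x y) x y = dy j (\<lambda>x y. h * f x y) x y"
    by (rule dy_cong) (use assms xy homogD in auto)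
  then have "(\<Sum>r\<in>UNIV. axis j 1 $ r * dy r f x y + y $ r * dy r (dy j f) x y) = h * dy j f x y"
    using assms xy by (simp add: d_rules dy_dy[of f _ _ j])
  then show "euler_op (dy j f) x y = h' * dy j f x y"
    unfolding assms(3) by (simp add: sum.distrib sum_axis euler_op_def left_diff_distrib)
qed

lemma homog_dx:
  assumes "sm f" "homog h f" shows "homog h (dx j f)"
  unfolding homog_def euler_op_def
proof (intro ballI allI impI)
  fix x y assume xy: "x \<in> U" "y \<noteq> (0 :: real ^ 'n)"
  have "dx j (\<lambda>x y. \<Sum>r\<in>UNIV. y $ r * dy r f x y) x y = dx j (\<lambda>x y. h * f x y) x y"
    by (rule dx_cong) (use assms xy homogD in auto)
  then show "(\<Sum>r\<in>UNIV. y $ r * dy r (dx j f) x y) = h * dx j f x y"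
    using assms xy by (simp add: d_rules dy_dx[of f])
qed

end

section \<open>Sprays and their covariant derivatives\<close>

lemma matrix_mult_matrix_inv:
  fixes A :: "real ^ 'n ^ 'n"
  assumes "det A \<noteq> 0" shows "A ** matrix_inv A = mat 1"
  using assms someI_ex[of "\<lambda>B. A ** B = mat 1 \<and> B ** A = mat 1"]
  unfolding invertible_det_nz[symmetric] invertible_def matrix_inv_def by blast

text \<open>Column \<open>l\<close> of the inverse solves \<open>A z = e_l\<close>, to which
  Cramer's rule applies. Writing the entries as quotients of determinants makes their smooth
  dependence on \<open>A\<close> visible.\<close>

lemma matrix_inv_cramer:
  fixes A :: "real ^ 'n ^ 'n"
  assumes "det A \<noteq> 0"
  shows "matrix_inv A $ i $ l = det (\<chi> r s. if s = i then axis l 1 $ r else A $ r $ s) / det A"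
proof -
  have "A *v (matrix_inv A *v axis l 1) = axis l 1"
    by (simp add: matrix_vector_mul_assoc matrix_mult_matrix_inv[OF assms])
  then have "matrix_inv A *v axis l 1
      = (\<chi> k. det (\<chi> r s. if s = k then axis l 1 $ r else A $ r $ s) / det A)"
    using cramer[OF assms] by blast
  then show ?thesis by (simp add: vec_eq_iff matrix_vector_mult_basis column_def)
qed

lemma pos_def_det:
  fixes A :: "real ^ 'n ^ 'n"
  assumes "\<And>\<xi>. \<xi> \<noteq> 0 \<Longrightarrow> \<xi> \<bullet> (A *v \<xi>) > 0"
  shows "det A \<noteq> 0"
proof -
  have "\<xi> = 0" if "A *v \<xi> = 0" for \<xi>
    using assms[of \<xi>] that by (cases "\<xi> = 0") auto
  then show ?thesis
    using invertible_det_nz[of A] invertible_left_inverse[of A] matrix_left_invertible_ker[of A]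
    by auto
qed

text \<open>
  The covariant derivative \<open>T\<^sub>|\<^sub>m y\<^sup>m\<close> along the spray; only the spray coefficients and their
  first derivatives survive the contraction with \<open>y\<close>.
\<close>

definition cov02 where
  "cov02 G w j k x y = spray_deriv G (w j k) x y
     - (\<Sum>r\<in>UNIV. w r k x y * dy j (G r) x y) - (\<Sum>r\<in>UNIV. w j r x y * dy k (G r) x y)"

definition cov03 where
  "cov03 G s j k l x y = spray_deriv G (s j k l) x y
     - (\<Sum>r\<in>UNIV. s r k l x y * dy j (G r) x y) - (\<Sum>r\<in>UNIV. s j r l x y * dy k (G r) x y)
     - (\<Sum>r\<in>UNIV. s j k r x y * dy l (G r) x y)"

definition cov13 where
  "cov13 G T j i k l x y = spray_deriv G (T j i k l) x y
     + (\<Sum>r\<in>UNIV. T j r k l x y * dy r (G i) x y)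
     - (\<Sum>r\<in>UNIV. T r i k l x y * dy j (G r) x y) - (\<Sum>r\<in>UNIV. T j i r l x y * dy k (G r) x y)
     - (\<Sum>r\<in>UNIV. T j i k r x y * dy l (G r) x y)"

text \<open>The covector \<open>y\<^sub>r / F\<^sup>2\<close>, which is parallel along the spray and has \<open>y\<close>-component one.\<close>

definition ly :: "(real ^ 'n::finite \<Rightarrow> real ^ 'n \<Rightarrow> real) \<Rightarrow> 'n \<Rightarrow> real ^ 'n \<Rightarrow> real ^ 'n \<Rightarrow> real" where
  "ly F r x y = dy r (fsq F) x y / (2 * fsq F x y)"

section \<open>Algebra of the covariant derivative along a spray\<close>

context slit_chart
begin

lemma cov13_cong:
  assumes "\<And>j i k l x y. x \<in> U \<Longrightarrow> y \<noteq> 0 \<Longrightarrow> T j i k l x y = T' j i k l x y" "x \<in> U" "y \<noteq> 0"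
  shows "cov13 G T j i k l x y = cov13 G T' j i k l x y"
  unfolding cov13_def using assms spray_deriv_cong[OF assms] by simp

lemma cov13_add:
  assumes "\<And>j i k l. sm (T j i k l)" "\<And>j i k l. sm (T' j i k l)" "x \<in> U" "y \<noteq> 0"
  shows "cov13 G (\<lambda>j i k l x y. T j i k l x y + T' j i k l x y) j i k l x y
    = cov13 G T j i k l x y + cov13 G T' j i k l x y"
  unfolding cov13_def using assms by (simp add: spray_deriv_add sum.distrib distrib_right)

lemma cov13_diff:
  assumes "\<And>j i k l. sm (T j i k l)" "\<And>j i k l. sm (T' j i k l)" "x \<in> U" "y \<noteq> 0"
  shows "cov13 G (\<lambda>j i k l x y. T j i k l x y - T' j i k l x y) j i k l x y
    = cov13 G T j i k l x y - cov13 G T' j i k l x y"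
  unfolding cov13_def using assms by (simp add: spray_deriv_diff sum_subtractf left_diff_distrib)

text \<open>The vector \<open>y\<close> is parallel: the spray sends \<open>y^i\<close> to
  \<open>-2 G^i\<close>, and the upper-index term contributes \<open>y^r G^i_r = 2 G^i\<close> by
  homogeneity.\<close>

lemma cov13_outer:
  assumes "\<And>j k l. sm (s j k l)" "\<And>i. homog 2 (G i)" "x \<in> U" "y \<noteq> 0"
  shows "cov13 G (\<lambda>j i k l x y. s j k l x y * y $ i) j i k l x y = cov03 G s j k l x y * y $ i"
proof -
  have "(\<Sum>r\<in>UNIV. s j k l x y * y $ r * dy r (G i) x y) = s j k l x y * (2 * G i x y)"
    unfolding homogD[OF assms(2-4), symmetric] by (simp add: sum_distrib_left mult.assoc)
  moreover have "(\<Sum>r\<in>UNIV. f r * y $ i * g r) = (\<Sum>r\<in>UNIV. f r * g r) * y $ i"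
    for f g :: "'n \<Rightarrow> real"
    by (simp add: sum_distrib_left mult_ac)
  ultimately show ?thesis unfolding cov13_def cov03_def
    using assms by (simp add: spray_deriv_mult spray_deriv_coord left_diff_distrib)
qed

text \<open>The Kronecker delta, written \<open>axis i 1 $ l\<close>, is parallel: the terms of its
  upper and its lower index cancel. The three statements cover the three places of the lower
  index.\<close>

lemma cov13_delta:
  assumes "\<And>j k. sm (w j k)" "x \<in> U" "y \<noteq> 0"
  shows "cov13 G (\<lambda>j i k l x y. w j k x y * axis i 1 $ l) j i k l x y
      = cov02 G w j k x y * axis i 1 $ l"
    and "cov13 G (\<lambda>j i k l x y. w j l x y * axis i 1 $ k) j i k l x y
      = cov02 G w j l x y * axis i 1 $ k"
    and "cov13 G (\<lambda>j i k l x y. w k l x y * axis i 1 $ j) j i k l x y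
      = cov02 G w k l x y * axis i 1 $ j"
proof -
  have *: "(\<Sum>r\<in>UNIV. f r * c * g r) = (\<Sum>r\<in>UNIV. f r * g r) * c"
    for f g :: "'n \<Rightarrow> real" and c
    by (simp add: sum_distrib_left mult_ac)
  have **: "(\<Sum>r\<in>UNIV. c * axis r 1 $ l * g r) = c * g l"
    "(\<Sum>r\<in>UNIV. c * axis i 1 $ r * g r) = c * g i"
    for g :: "'n \<Rightarrow> real" and c i l
    by (simp_all add: sum_axis mult.assoc flip: sum_distrib_left)
  show "cov13 G (\<lambda>j i k l x y. w j k x y * axis i 1 $ l) j i k l x y
      = cov02 G w j k x y * axis i 1 $ l"
    and "cov13 G (\<lambda>j i k l x y. w j l x y * axis i 1 $ k) j i k l x y
      = cov02 G w j l x y * axis i 1 $ k"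
    and "cov13 G (\<lambda>j i k l x y. w k l x y * axis i 1 $ j) j i k l x y
      = cov02 G w k l x y * axis i 1 $ j"
    unfolding cov13_def cov02_def using assms
    by (simp_all add: spray_deriv_mult spray_deriv_const * ** left_diff_distrib)
qed

text \<open>Leibniz rule for contraction with a covector \<open>a\<close> that is parallel along the
  spray, which is what \<open>Sa\<close> says. Its derivative then supplies exactly the upper-index
  term of \<open>T\<close>.\<close>

lemma cov03_contract:
  assumes T: "\<And>j i k l. sm (T j i k l)" and a: "\<And>r. sm (a r)"
    and Sa: "\<And>r. spray_deriv G (a r) x y = (\<Sum>s\<in>UNIV. a s x y * dy r (G s) x y)"
    and xy: "x \<in> U" "y \<noteq> 0"
  shows "cov03 G (\<lambda>j k l x y. \<Sum>r\<in>UNIV. a r x y * T j r k l x y) j k l x y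
    = (\<Sum>r\<in>UNIV. a r x y * cov13 G T j r k l x y)"
proof -
  have 1: "(\<Sum>r\<in>UNIV. spray_deriv G (a r) x y * T j r k l x y)
      = (\<Sum>r\<in>UNIV. a r x y * (\<Sum>s\<in>UNIV. T j s k l x y * dy s (G r) x y))"
    unfolding Sa sum_distrib_left sum_distrib_right
    by (subst sum.swap) (simp add: mult_ac)
  have 2: "(\<Sum>r\<in>UNIV. (\<Sum>s\<in>UNIV. a s x y * f s r) * g r)
      = (\<Sum>s\<in>UNIV. a s x y * (\<Sum>r\<in>UNIV. f s r * g r))" for f :: "'n \<Rightarrow> 'n \<Rightarrow> real" and g
    unfolding sum_distrib_left sum_distrib_right by (subst sum.swap) (simp add: mult_ac)
  show ?thesis unfolding cov03_def cov13_def
    using T a xy 1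
    by (simp add: spray_deriv_sum spray_deriv_mult 2 sum.distrib sum_subtractf
        right_diff_distrib distrib_left)
qed

text \<open>
  Replacing \<open>G\<close> by \<open>G + P y\<close> adds the contributions \<open>2P\<close> (degree \<open>-1\<close>), \<open>P\<close> (upper index) and
  \<open>-3P\<close> (lower indices), which cancel.
\<close>

lemma cov13_projective:
  assumes G: "\<And>i. sm (G i)" and P: "sm P"
    and G': "\<And>i x y. x \<in> U \<Longrightarrow> y \<noteq> 0 \<Longrightarrow> G' i x y = G i x y + P x y * y $ i"
    and T: "homog (-1) (T j i k l)"
    and T0: "\<And>i k l. (\<Sum>r\<in>UNIV. T r i k l x y * y $ r) = 0"
      "\<And>j i l. (\<Sum>r\<in>UNIV. T j i r l x y * y $ r) = 0"
      "\<And>j i k. (\<Sum>r\<in>UNIV. T j i k r x y * y $ r) = 0"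
    and xy: "x \<in> U" "y \<noteq> 0"
  shows "cov13 G' T j i k l x y
    = cov13 G T j i k l x y + (\<Sum>r\<in>UNIV. T j r k l x y * dy r P x y) * y $ i"
proof -
  have dG': "dy r (G' i) x y = dy r (G i) x y + dy r P x y * y $ i + P x y * axis r 1 $ i" for r i
  proof -
    have "dy r (G' i) x y = dy r (\<lambda>x y. G i x y + P x y * y $ i) x y"
      by (rule dy_cong[OF G' xy])
    then show ?thesis using G P xy by (simp add: d_rules)
  qed
  \<comment> \<open>The two spray fields differ by \<open>-2P\<close> times the Euler field, whose
    value on \<open>T\<close> is known from its degree.\<close>
  have S: "spray_deriv G' f x y = spray_deriv G f x y - 2 * P x y * (\<Sum>r\<in>UNIV. y $ r * dy r f x y)"
    for f
    unfolding spray_deriv_def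
    using xy by (simp add: G' sum.distrib sum_distrib_left algebra_simps)
  have up: "(\<Sum>r\<in>UNIV. T j r k l x y * dy r (G' i) x y) = (\<Sum>r\<in>UNIV. T j r k l x y * dy r (G i) x y)
      + (\<Sum>r\<in>UNIV. T j r k l x y * dy r P x y) * y $ i + P x y * T j i k l x y"
  proof -
    have "T j r k l x y * dy r (G' i) x y = T j r k l x y * dy r (G i) x y
        + T j r k l x y * dy r P x y * y $ i + P x y * (T j r k l x y * axis r 1 $ i)" for r
      by (simp add: dG' algebra_simps)
    then show ?thesis
      by (simp add: sum.distrib sum_distrib_left[symmetric] sum_distrib_right[symmetric] sum_axis)
  qed
  \<comment> \<open>Transversality kills the part of \<open>dy m (G' r)\<close> along
    \<open>y\<close>; only the Kronecker part survives.\<close>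
  have low: "(\<Sum>r\<in>UNIV. f r * dy m (G' r) x y) = (\<Sum>r\<in>UNIV. f r * dy m (G r) x y) + P x y * f m"
    if "(\<Sum>r\<in>UNIV. f r * y $ r) = 0" for f m
  proof -
    have "f r * dy m (G' r) x y = f r * dy m (G r) x y
        + dy m P x y * (f r * y $ r) + P x y * (f r * axis m 1 $ r)" for r
      by (simp add: dG' algebra_simps)
    then show ?thesis
      using that by (simp add: sum.distrib sum_distrib_left[symmetric] sum_axis)
  qed
  show ?thesis
    unfolding cov13_def S homogD[OF T xy] up
    by (subst low[OF T0(1)], subst low[OF T0(2)], subst low[OF T0(3)]) (simp add: algebra_simps)
qed

end

section \<open>The spray of a Finsler metric, expressed through its square\<close>

locale finsler_chart = slit_chart U for U :: "(real ^ 'n::finite) set" +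
  fixes F :: "real ^ 'n \<Rightarrow> real ^ 'n \<Rightarrow> real"
  assumes sm_fsq [simp]: "sm (fsq F)"
    and homog_fsq: "homog 2 (fsq F)"
    and pos_def: "x \<in> U \<Longrightarrow> y \<noteq> 0 \<Longrightarrow> \<xi> \<noteq> 0 \<Longrightarrow> \<xi> \<bullet> (fund_tensor F x y *v \<xi>) > 0"
begin

abbreviation "L \<equiv> fsq F"

lemma det_fund_tensor: "x \<in> U \<Longrightarrow> y \<noteq> 0 \<Longrightarrow> det (fund_tensor F x y) \<noteq> 0"
  by (rule pos_def_det) (rule pos_def)

lemma sm_spray [simp]: "sm (spray F i)"
proof -
  let ?N = "\<lambda>l x y. det (\<chi> r s. if s = i then axis l 1 $ r else 1 / 2 * dy r (dy s L) x y)"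
  let ?D = "\<lambda>x y. det (\<chi> r s. 1 / 2 * dy r (dy s L) x y)"
  have "sm (\<lambda>x y. if s = i then axis l 1 $ r else 1 / 2 * dy r (dy s L) x y)" for l r s
    by (cases "s = i") auto
  then have N: "sm (?N l)" for l by (rule sm_det)
  have D: "sm ?D" by (intro sm_det) auto
  have D0: "?D x y \<noteq> 0" if "x \<in> U" "y \<noteq> 0" for x y
    using det_fund_tensor[OF that] by (simp add: fund_tensor_def)
  have "sm (\<lambda>x y. 1 / 4 * (\<Sum>l\<in>UNIV. ?N l x y / ?D x y *
     ((\<Sum>k\<in>UNIV. dx k (dy l L) x y * y $ k) - dx l L x y)))"
    by (intro sm_mult sm_const sm_sum sm_divide[OF N D D0] sm_diff sm_dx sm_dy sm_fsq sm_coord)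
  then show ?thesis
  proof (rule sm_cong)
    fix x y assume xy: "x \<in> U" "y \<noteq> (0 :: real ^ 'n)"
    show "1 / 4 * (\<Sum>l\<in>UNIV. ?N l x y / ?D x y *
     ((\<Sum>k\<in>UNIV. dx k (dy l L) x y * y $ k) - dx l L x y)) = spray F i x y"
      unfolding spray_def matrix_inv_cramer[OF det_fund_tensor[OF xy]]
      by (simp add: fund_tensor_def cong: if_cong)
  qed
qed

text \<open>Multiplying the definition of the spray by the fundamental tensor removes the inverse
  matrix. This is the Euler-Lagrange equation of the energy.\<close>

lemma spray_eq:
  assumes "x \<in> U" "y \<noteq> 0"
  shows "2 * (\<Sum>i\<in>UNIV. spray F i x y * dy l (dy i L) x y)
    = (\<Sum>k\<in>UNIV. y $ k * dx k (dy l L) x y) - dx l L x y"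
proof -
  let ?g = "fund_tensor F x y"
  let ?R = "\<chi> l. (\<Sum>k\<in>UNIV. dx k (dy l L) x y * y $ k) - dx l L x y"
  have G: "(\<chi> i. spray F i x y) = (1 / 4) *\<^sub>R (matrix_inv ?g *v ?R)"
    by (simp add: vec_eq_iff spray_def matrix_vector_mult_def)
  have "?g ** matrix_inv ?g = mat 1"
    by (rule matrix_mult_matrix_inv[OF det_fund_tensor[OF assms]])
  then have "?g *v (\<chi> i. spray F i x y) = (1 / 4) *\<^sub>R ?R"
    unfolding G by (simp add: matrix_vector_mult_scaleR matrix_vector_mul_assoc)
  then have "(\<Sum>i\<in>UNIV. 1 / 2 * dy l (dy i L) x y * spray F i x y) = 1 / 4 * (?R $ l)"
    by (simp add: vec_eq_iff matrix_vector_mult_def fund_tensor_def)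
  moreover have "(\<Sum>i\<in>UNIV. 1 / 2 * dy l (dy i L) x y * spray F i x y)
      = 1 / 2 * (\<Sum>i\<in>UNIV. spray F i x y * dy l (dy i L) x y)"
    by (simp add: sum_distrib_left mult_ac)
  ultimately show ?thesis by (simp add: mult.commute)
qed

text \<open>In \<open>spray_eq\<close> the right side has degree two and the Hessian of
  \<open>F^2\<close> has degree zero. Hence the fundamental tensor annihilates the vector
  \<open>?e\<close>, the defect in Euler's equation, and positive definiteness makes it
  vanish.\<close>

lemma homog_spray: "homog 2 (spray F i)"
proof -
  note [simp] = d_rules sum.distrib
  have "euler_op (spray F i) x y = 2 * spray F i x y" if xy: "x \<in> U" "y \<noteq> 0" for x y i
  proof -
    let ?G = "spray F" and ?g = "\<lambda>l i. dy l (dy i L)"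
    let ?e = "\<chi> i. euler_op (?G i) x y - 2 * ?G i x y"
    have g0: "homog 0 (?g l i)" for l i
      by (intro homog_dy[where h = 1] homog_dy[where h = 2] homog_fsq) auto
    have "(fund_tensor F x y *v ?e) $ l = 0" for l
    proof -
      let ?R = "\<lambda>x y. (\<Sum>k\<in>UNIV. y $ k * dx k (dy l L) x y) - dx l L x y"
      have "homog 2 ?R"
        by (intro homog_diff homog_sum homog_mult[where h = 1 and h' = 1] homog_coord homog_dx
            homog_dy[where h = 2] homog_fsq) auto
      then have "euler_op ?R x y = 2 * ?R x y" using xy by (simp add: homog_def)
      moreover have "euler_op ?R x y = euler_op (\<lambda>x y. \<Sum>i\<in>UNIV. 2 * (?G i x y * ?g l i x y)) x y"
        by (rule euler_op_cong[OF _ xy]) (simp add: spray_eq flip: sum_distrib_left)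
      moreover have "euler_op (\<lambda>x y. \<Sum>i\<in>UNIV. 2 * (?G i x y * ?g l i x y)) x y
          = (\<Sum>i\<in>UNIV. 2 * (euler_op (?G i) x y * ?g l i x y + ?G i x y * euler_op (?g l i) x y))"
      proof -
        have "euler_op (\<lambda>x y. \<Sum>i\<in>UNIV. 2 * (?G i x y * ?g l i x y)) x y
          = (\<Sum>r\<in>UNIV. \<Sum>i\<in>UNIV.
              2 * (y $ r * dy r (?G i) x y * ?g l i x y + ?G i x y * (y $ r * dy r (?g l i) x y)))"
          unfolding euler_op_def using xy
          by (simp add: sum_distrib_left algebra_simps)
        also have "\<dots> = (\<Sum>i\<in>UNIV. \<Sum>r\<in>UNIV.
              2 * (y $ r * dy r (?G i) x y * ?g l i x y + ?G i x y * (y $ r * dy r (?g l i) x y)))"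
          by (rule sum.swap)
        finally show ?thesis
          unfolding euler_op_def by (simp add: sum_distrib_left sum_distrib_right)
      qed
      moreover have "euler_op (?g l i) x y = 0" for i
        using g0[of l i] xy by (simp add: homog_def)
      moreover have "?R x y = (\<Sum>i\<in>UNIV. 2 * (?G i x y * ?g l i x y))"
        using spray_eq[OF xy, of l] by (simp add: sum_distrib_left)
      ultimately have "(\<Sum>i\<in>UNIV. 2 * (euler_op (?G i) x y * ?g l i x y))
          = 2 * (\<Sum>i\<in>UNIV. 2 * (?G i x y * ?g l i x y))" by simp
      then have "(\<Sum>i\<in>UNIV. ?g l i x y * (euler_op (?G i) x y - 2 * ?G i x y)) = 0"
        by (simp add: right_diff_distrib sum_subtractf mult_ac flip: sum_distrib_left)
      then show ?thesis
        by (simp add: matrix_vector_mult_def fund_tensor_def flip: sum_divide_distrib)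
    qed
    then have e: "fund_tensor F x y *v ?e = 0" by (simp only: vec_eq_iff zero_index) simp
    have "?e = 0"
    proof (rule ccontr)
      assume "?e \<noteq> 0"
      from pos_def[OF xy this] show False unfolding e by simp
    qed
    then show ?thesis by (simp add: vec_eq_iff)
  qed
  then show ?thesis by (simp add: homog_def)
qed

text \<open>Euler's equation, used for \<open>L\<close> and for its first derivatives, shows that
  \<open>L\<close> is the value of the fundamental tensor on the pair \<open>(y, y)\<close>.\<close>

lemma fsq_pos: assumes "x \<in> U" "y \<noteq> 0" shows "L x y > 0"
proof -
  have "homog 1 (dy i L)" for i by (rule homog_dy[OF sm_fsq homog_fsq]) simp
  from homogD[OF this assms]
  have 1: "(\<Sum>j\<in>UNIV. dy i (dy j L) x y * y $ j) = dy i L x y" for i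
    by (simp add: mult.commute dy_dy[OF sm_fsq assms, of i])
  have "y \<bullet> (fund_tensor F x y *v y)
      = (\<Sum>i\<in>UNIV. y $ i * (1 / 2 * (\<Sum>j\<in>UNIV. dy i (dy j L) x y * y $ j)))"
    by (simp add: inner_vec_def matrix_vector_mult_def fund_tensor_def sum_distrib_left mult_ac)
  also have "\<dots> = 1 / 2 * (\<Sum>i\<in>UNIV. y $ i * dy i L x y)"
    unfolding 1 by (simp add: sum_distrib_left mult_ac)
  also have "\<dots> = L x y" using homogD[OF homog_fsq assms] by simp
  finally show ?thesis using pos_def[OF assms assms(2)] by simp
qed

lemma spray_deriv_dy_fsq:
  assumes "x \<in> U" "y \<noteq> 0"
  shows "spray_deriv (spray F) (dy l L) x y = dx l L x y"
  using spray_eq[OF assms, of l] dy_dy[OF sm_fsq assms] by (simp add: spray_deriv_def)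

text \<open>Conservation of energy along geodesics. The Euler-Lagrange equation is contracted with
  \<open>y^l\<close>; by homogeneity the left side becomes the spray derivative of \<open>L\<close>
  plus the term that already stands on the right.\<close>

lemma spray_deriv_fsq:
  assumes xy: "x \<in> U" "y \<noteq> 0"
  shows "spray_deriv (spray F) L x y = 0"
proof -
  have "homog 2 (dx k L)" "homog 1 (dy k L)" for k
    by (auto intro!: homog_dx homog_dy[where h = 2] homog_fsq)
  note e = this[THEN homogD[OF _ xy]]
  have "(\<Sum>l\<in>UNIV. y $ l * spray_deriv (spray F) (dy l L) x y)
      = (\<Sum>l\<in>UNIV. \<Sum>k\<in>UNIV. y $ l * (y $ k * dx k (dy l L) x y))
      - 2 * (\<Sum>l\<in>UNIV. \<Sum>r\<in>UNIV. y $ l * (spray F r x y * dy r (dy l L) x y))"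
    by (simp add: spray_deriv_def right_diff_distrib sum_subtractf sum_distrib_left mult_ac)
  also have "\<dots> = (\<Sum>k\<in>UNIV. y $ k * (\<Sum>l\<in>UNIV. y $ l * dy l (dx k L) x y))
      - 2 * (\<Sum>r\<in>UNIV. spray F r x y * (\<Sum>l\<in>UNIV. y $ l * dy l (dy r L) x y))"
    using dy_dx[OF sm_fsq xy] dy_dy[OF sm_fsq xy]
    by (subst sum.swap, subst (2) sum.swap) (simp add: sum_distrib_left mult_ac)
  also have "\<dots> = spray_deriv (spray F) L x y + (\<Sum>k\<in>UNIV. y $ k * dx k L x y)"
    unfolding e spray_deriv_def by (simp add: algebra_simps sum_distrib_left)
  finally show ?thesis unfolding spray_deriv_dy_fsq[OF xy] by simp
qed

lemma sm_ly [simp]: "sm (ly F r)"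
  unfolding ly_def using fsq_pos less_irrefl by (intro sm_divide) fastforce+

lemma ly_y: "x \<in> U \<Longrightarrow> y \<noteq> 0 \<Longrightarrow> (\<Sum>r\<in>UNIV. ly F r x y * y $ r) = 1"
  using homogD[OF homog_fsq, of x y] fsq_pos[of x y]
  by (simp add: ly_def mult.commute flip: sum_divide_distrib)

text \<open>Differentiating the conservation law in \<open>y^r\<close> and inserting the
  Euler-Lagrange equation gives the transport equation for \<open>dy r L\<close>; the factor
  \<open>2 L\<close> is constant along the spray and can be divided out.\<close>

lemma spray_deriv_ly:
  assumes xy: "x \<in> U" "y \<noteq> 0"
  shows "spray_deriv (spray F) (ly F r) x y = (\<Sum>s\<in>UNIV. ly F s x y * dy r (spray F s) x y)"
proof -
  let ?S = "spray_deriv (spray F)"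
  have "dy r (?S L) x y = dy r (\<lambda>x y. 0) x y"
    by (rule dy_cong[OF spray_deriv_fsq xy])
  then have 1: "?S (dy r L) x y = (\<Sum>s\<in>UNIV. dy r (spray F s) x y * dy s L x y)"
    using dy_spray_deriv[of "spray F" L x y r] spray_deriv_dy_fsq[OF xy] xy by (simp add: d_rules)
  have "?S (\<lambda>x y. ly F r x y * (2 * L x y)) x y = ?S (dy r L) x y"
  proof (rule spray_deriv_cong[OF _ xy])
    show "ly F r x y * (2 * L x y) = dy r L x y" if "x \<in> U" "y \<noteq> 0" for x y
      using fsq_pos[OF that] by (simp add: ly_def)
  qed
  then have "?S (ly F r) x y * (2 * L x y) = ?S (dy r L) x y"
    using xy spray_deriv_fsq[OF xy] by (simp add: spray_deriv_mult spray_deriv_const)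
  then show ?thesis
    unfolding 1 using fsq_pos[OF xy]
    by (simp add: ly_def mult_ac field_simps flip: sum_divide_distrib)
qed

text \<open>By homogeneity \<open>G^i_{rm} y^m = G^i_r\<close> and \<open>G^r_m y^m = 2 G^r\<close>.
  This connects the condition in the definition of the metric class with
  \<open>cov13\<close>.\<close>

lemma berwald_cov_spray:
  assumes xy: "x \<in> U" "y \<noteq> 0"
  shows "(\<Sum>m\<in>UNIV. berwald_cov F T j i k l m x y * y $ m) = cov13 (spray F) T j i k l x y"
proof -
  have N: "(\<Sum>m\<in>UNIV. spray2 F i r m x y * y $ m) = dy r (spray F i) x y" for i r
  proof -
    have "homog 1 (dy r (spray F i))" by (rule homog_dy[OF sm_spray homog_spray]) simp
    from homogD[OF this xy] show ?thesis
      by (simp add: spray2_def dy_dy[OF sm_spray xy, of r] mult.commute)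
  qed
  have *: "(\<Sum>m\<in>UNIV. (\<Sum>r\<in>UNIV. f r * g r m) * y $ m) = (\<Sum>r\<in>UNIV. f r * (\<Sum>m\<in>UNIV. g r m * y $ m))"
    for f :: "'n \<Rightarrow> real" and g
    unfolding sum_distrib_left sum_distrib_right by (subst sum.swap) (simp add: mult_ac)
  have H: "(\<Sum>m\<in>UNIV. hor_deriv F m f x y * y $ m) = spray_deriv (spray F) f x y" for f
  proof -
    have "(\<Sum>m\<in>UNIV. (\<Sum>r\<in>UNIV. spray1 F r m x y * dy r f x y) * y $ m)
        = (\<Sum>r\<in>UNIV. dy r f x y * (\<Sum>m\<in>UNIV. spray1 F r m x y * y $ m))"
      unfolding sum_distrib_left sum_distrib_right by (subst sum.swap) (simp add: mult_ac)
    also have "\<dots> = 2 * (\<Sum>r\<in>UNIV. spray F r x y * dy r f x y)"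
      using homogD[OF homog_spray xy]
      by (simp add: spray1_def mult.commute sum_distrib_left) (simp add: mult_ac)
    finally show ?thesis
      by (simp add: hor_deriv_def spray_deriv_def right_diff_distrib sum_subtractf mult.commute)
  qed
  show ?thesis
    unfolding berwald_cov_def cov13_def
    by (simp add: distrib_right left_diff_distrib sum.distrib sum_subtractf * H N)
qed

end

section \<open>C-projective changes in a coordinate domain\<close>

text \<open>
  The component of the Berwald curvature along \<open>y\<close>, which takes the role of \<open>b\<close>, and the
  complementary part, which takes the role of \<open>\<beta>\<close>.
\<close>

definition berwald_vert where
  "berwald_vert F j k l x y = (\<Sum>r\<in>UNIV. ly F r x y * berwald_curv F j r k l x y)"

definition berwald_hor where
  "berwald_hor F j i k l x y = berwald_curv F j i k l x y - berwald_vert F j k l x y * y $ i"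

lemma axis_swap: "axis i (1 :: real) $ l = axis l 1 $ i"
  by (simp add: axis_def)

context finsler_chart
begin

lemma sm_berwald_curv [simp]: "sm (berwald_curv F j i k l)"
  by (simp add: berwald_curv_def)

lemma homog_berwald_curv: "homog (-1) (berwald_curv F j i k l)"
  unfolding berwald_curv_def
  by (intro homog_dy[where h = 0] homog_dy[where h = 1] homog_dy[where h = 2] homog_spray) auto

text \<open>Second vertical derivatives of the spray have degree zero, so Euler's equation gives the
  first claim; symmetry of the derivatives moves the other lower indices to the front.\<close>

lemma berwald_curv_y:
  assumes xy: "x \<in> U" "y \<noteq> 0"
  shows "(\<Sum>r\<in>UNIV. berwald_curv F r i k l x y * y $ r) = 0"
    and "(\<Sum>r\<in>UNIV. berwald_curv F j i r l x y * y $ r) = 0"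
    and "(\<Sum>r\<in>UNIV. berwald_curv F j i k r x y * y $ r) = 0"
proof -
  have *: "(\<Sum>r\<in>UNIV. dy r (dy j (dy k (spray F i))) x y * y $ r) = 0" for j k
  proof -
    have "homog 0 (dy j (dy k (spray F i)))"
      by (intro homog_dy[where h = 1] homog_dy[where h = 2] homog_spray) auto
    from homogD[OF this xy] show ?thesis by (simp add: mult.commute)
  qed
  show "(\<Sum>r\<in>UNIV. berwald_curv F r i k l x y * y $ r) = 0"
    unfolding berwald_curv_def by (rule *)
  have 2: "dy j (dy r (dy l (spray F i))) x y = dy r (dy j (dy l (spray F i))) x y" for j r l
    by (rule dy_dy[OF _ xy]) simp
  show "(\<Sum>r\<in>UNIV. berwald_curv F j i r l x y * y $ r) = 0"
    unfolding berwald_curv_def by (simp only: 2[of j] *)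
  have "dy j (dy k (dy r (spray F i))) x y = dy j (dy r (dy k (spray F i))) x y" for r
    by (rule dy_cong[OF dy_dy[OF sm_spray] xy])
  then show "(\<Sum>r\<in>UNIV. berwald_curv F j i k r x y * y $ r) = 0"
    unfolding berwald_curv_def by (simp only: 2[of j] *)
qed

lemma sm_berwald_vert [simp]: "sm (berwald_vert F j k l)"
  unfolding berwald_vert_def[abs_def] by (intro sm_sum sm_mult sm_ly sm_berwald_curv)

lemma sm_berwald_hor [simp]: "sm (berwald_hor F j i k l)"
  unfolding berwald_hor_def[abs_def] by (intro sm_diff sm_mult sm_coord sm_berwald_curv sm_berwald_vert)

text \<open>Contracting with \<open>ly F\<close> recovers \<open>a\<close>, so removing the vertical part removes \<open>a y\<close>.\<close>

lemma cov13_berwald_hor: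
  assumes a: "\<And>i. cov13 (spray F) (berwald_curv F) j i k l x y = a * y $ i"
    and xy: "x \<in> U" "y \<noteq> 0"
  shows "cov13 (spray F) (berwald_hor F) j i k l x y = 0"
proof -
  have "cov13 (spray F) (berwald_hor F) j i k l x y
      = cov13 (spray F) (berwald_curv F) j i k l x y
        - cov13 (spray F) (\<lambda>j i k l x y. berwald_vert F j k l x y * y $ i) j i k l x y"
    unfolding berwald_hor_def[abs_def] by (intro cov13_diff xy) simp_all
  also have "cov13 (spray F) (\<lambda>j i k l x y. berwald_vert F j k l x y * y $ i) j i k l x y
      = cov03 (spray F) (berwald_vert F) j k l x y * y $ i"
    by (intro cov13_outer homog_spray xy) simp
  also have "cov03 (spray F) (berwald_vert F) j k l x y
      = (\<Sum>r\<in>UNIV. ly F r x y * cov13 (spray F) (berwald_curv F) j r k l x y)"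
    unfolding berwald_vert_def[abs_def] by (intro cov03_contract spray_deriv_ly xy) simp_all
  also have "\<dots> = a * (\<Sum>r\<in>UNIV. ly F r x y * y $ r)"
    unfolding a sum_distrib_left by (simp add: mult_ac)
  finally show ?thesis unfolding ly_y[OF xy] a by simp
qed

end

locale projective_charts = slit_chart U + old: finsler_chart U F + new: finsler_chart U F'
  for U :: "(real ^ 'n::finite) set" and F F' +
  fixes P :: "real ^ 'n \<Rightarrow> real ^ 'n \<Rightarrow> real"
  assumes sm_P [simp]: "sm P" and homog_P: "homog 1 P"
    and spray_change: "x \<in> U \<Longrightarrow> y \<noteq> 0 \<Longrightarrow> spray F' i x y = spray F i x y + P x y * y $ i"
begin

text \<open>Of the three derivatives applied to \<open>P y^i\<close>, at most one can fall on
  \<open>y^i\<close>, where it leaves a Kronecker delta.\<close>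

lemma berwald_curv_change:
  assumes xy: "x \<in> U" "y \<noteq> 0"
  shows "berwald_curv F' j i k l x y = berwald_curv F j i k l x y + dy j (dy k (dy l P)) x y * y $ i
    + (dy k (dy l P) x y * axis i 1 $ j + dy j (dy l P) x y * axis i 1 $ k
       + dy j (dy k P) x y * axis i 1 $ l)"
proof -
  have 1: "dy l (spray F' i) x y = dy l (spray F i) x y + dy l P x y * y $ i + P x y * axis l 1 $ i"
    if "x \<in> U" "y \<noteq> 0" for x y l
  proof -
    have "dy l (spray F' i) x y = dy l (\<lambda>x y. spray F i x y + P x y * y $ i) x y"
      by (rule dy_cong[OF spray_change that])
    then show ?thesis using that by (simp add: d_rules)
  qed
  have 2: "dy k (dy l (spray F' i)) x y = dy k (dy l (spray F i)) x y
      + dy k (dy l P) x y * y $ i + dy l P x y * axis k 1 $ i + dy k P x y * axis l 1 $ i"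
    if "x \<in> U" "y \<noteq> 0" for x y k l
  proof -
    have "dy k (dy l (spray F' i)) x y
        = dy k (\<lambda>x y. dy l (spray F i) x y + dy l P x y * y $ i + P x y * axis l 1 $ i) x y"
      by (rule dy_cong[OF 1 that])
    then show ?thesis using that by (simp add: d_rules)
  qed
  have "dy j (dy k (dy l (spray F' i))) x y = dy j (\<lambda>x y. dy k (dy l (spray F i)) x y
      + dy k (dy l P) x y * y $ i + dy l P x y * axis k 1 $ i + dy k P x y * axis l 1 $ i) x y"
    by (rule dy_cong[OF 2 xy])
  then show ?thesis
    using xy by (simp add: d_rules berwald_curv_def axis_swap[of i])
qed

text \<open>
  Contracting \<open>P\<^sub>i\<^sub>|\<^sub>j = P\<^sub>j\<^sub>|\<^sub>i\<close>, which is \<open>Q\<^sub>i\<^sub>j = 0\<close>, with \<open>y\<^sup>j\<close> and differentiating the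
  result shows that the vertical Hessian of \<open>P\<close> is parallel along the spray.
\<close>

lemma cov02_hessian:
  assumes Q: "\<And>i j x y. x \<in> U \<Longrightarrow> y \<noteq> 0 \<Longrightarrow> Q2 F P i j x y = 0"
    and xy: "x \<in> U" "y \<noteq> 0"
  shows "cov02 (spray F) (\<lambda>j k. dy j (dy k P)) k i x y = 0"
proof -
  let ?G = "spray F"
  \<comment> \<open>The horizontal derivative of \<open>P_i\<close> in direction \<open>j\<close>.
    All other terms in the vertical derivative of \<open>Q1\<close> are symmetric in
    \<open>i\<close> and \<open>j\<close>, so the vanishing of \<open>Q2\<close> is the symmetry of
    \<open>?H\<close>.\<close>
  let ?H = "\<lambda>i j x y. dx j (dy i P) x y - (\<Sum>m\<in>UNIV. dy j (?G m) x y * dy i (dy m P) x y)"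
  have H: "?H i j x y = ?H j i x y" if xy: "x \<in> U" "y \<noteq> 0" for i j x y
  proof -
    have Q1: "dy i (Q1 F P j) x y = dx j (dy i P) x y
        - (\<Sum>m\<in>UNIV. dy i (dy j (?G m)) x y * dy m P x y + dy j (?G m) x y * dy i (dy m P) x y)
        - (dy i P x y * dy j P x y + P x y * dy i (dy j P) x y)" for i j
    proof -
      have "Q1 F P j = (\<lambda>x y. dx j P x y - (\<Sum>m\<in>UNIV. dy j (?G m) x y * dy m P x y) - P x y * dy j P x y)"
        by (simp add: Q1_def spray1_def fun_eq_iff)
      then show ?thesis using xy by (simp add: d_rules dy_dx[OF sm_P xy, of i j])
    qed
    have "dy j (dy i (?G m)) x y = dy i (dy j (?G m)) x y" for m
      by (rule dy_dy[OF old.sm_spray xy])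
    moreover have "dy j (dy i P) x y = dy i (dy j P) x y"
      by (rule dy_dy[OF sm_P xy])
    ultimately show ?thesis
      using Q[OF xy, of i j] by (simp add: Q2_def Q1 sum.distrib)
  qed
  \<comment> \<open>Contracting \<open>?H i j\<close> with \<open>y^j\<close> gives the spray
    derivative of \<open>P_i\<close>. Contracting the transposed \<open>?H j i\<close> leaves
    \<open>dx i P\<close>, since \<open>P_m\<close> has degree zero.\<close>
  have S: "spray_deriv ?G (dy i P) x y = dx i P x y" if xy: "x \<in> U" "y \<noteq> 0" for i x y
  proof -
    have "homog 1 (dx i P)" "homog 0 (dy m P)" for m
      by (auto intro!: homog_dx homog_dy[where h = 1] homog_P)
    note h = this[THEN homogD[OF _ xy]] homogD[OF old.homog_spray xy]
    have *: "(\<Sum>j\<in>UNIV. y $ j * (a j - (\<Sum>m\<in>UNIV. b j m * c j m)))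
        = (\<Sum>j\<in>UNIV. y $ j * a j) - (\<Sum>m\<in>UNIV. \<Sum>j\<in>UNIV. y $ j * (b j m * c j m))"
      for a :: "'n \<Rightarrow> real" and b c
      by (subst sum.swap) (simp add: right_diff_distrib sum_subtractf sum_distrib_left)
    have "(\<Sum>m\<in>UNIV. \<Sum>j\<in>UNIV. y $ j * (dy j (?G m) x y * dy i (dy m P) x y))
        = (\<Sum>m\<in>UNIV. (\<Sum>j\<in>UNIV. y $ j * dy j (?G m) x y) * dy m (dy i P) x y)"
      by (simp add: sum_distrib_right mult.assoc dy_dy[OF sm_P xy, of i])
    then have "spray_deriv ?G (dy i P) x y = (\<Sum>j\<in>UNIV. y $ j * ?H i j x y)"
      unfolding * h spray_deriv_def by (simp add: sum_distrib_left mult.assoc)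
    also have "\<dots> = (\<Sum>j\<in>UNIV. y $ j * ?H j i x y)" using H[OF xy, of i] by simp
    also have "\<dots> = (\<Sum>j\<in>UNIV. y $ j * dy j (dx i P) x y)
        - (\<Sum>m\<in>UNIV. dy i (?G m) x y * (\<Sum>j\<in>UNIV. y $ j * dy j (dy m P) x y))"
      unfolding * by (simp add: sum_distrib_left mult.left_commute dy_dx[OF sm_P xy])
    finally show ?thesis unfolding h by simp
  qed
  have "dy k (spray_deriv ?G (dy i P)) x y = dy k (dx i P) x y"
    by (rule dy_cong[OF S xy])
  then have "spray_deriv ?G (dy k (dy i P)) x y = dx i (dy k P) x y - dx k (dy i P) x y
      + 2 * (\<Sum>r\<in>UNIV. dy k (?G r) x y * dy r (dy i P) x y)"
    using dy_spray_deriv[of ?G "dy i P" x y k] xy by (simp add: dy_dx[OF sm_P xy, of k i])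
  \<comment> \<open>The symmetry \<open>H\<close> rewrites the difference of mixed derivatives;
    together with the doubled sum this gives exactly the two connection terms of
    \<open>cov02\<close>.\<close>
  then show ?thesis
    using H[OF xy, of k i] unfolding cov02_def
    by (simp add: mult.commute dy_dy[OF sm_P xy, of i])
qed

text \<open>Along the old spray, \<open>\<beta>\<close> and the three Hessian terms are parallel, so
  only a multiple of \<open>y^i\<close> survives; passing to the new spray adds another. The factor
  \<open>a\<close> is the same for all \<open>i\<close>, as \<open>cov13_berwald_hor\<close>
  requires.\<close>

lemma cov13_berwald_curv_change:
  assumes Q: "\<And>i j x y. x \<in> U \<Longrightarrow> y \<noteq> 0 \<Longrightarrow> Q2 F P i j x y = 0"
    and \<beta>: "\<And>j i k l. sm (\<beta> j i k l)" and b: "\<And>j k l. sm (b j k l)"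
    and B: "\<And>j i k l x y. x \<in> U \<Longrightarrow> y \<noteq> 0 \<Longrightarrow>
      berwald_curv F j i k l x y = \<beta> j i k l x y + b j k l x y * y $ i"
    and \<beta>0: "\<And>i. cov13 (spray F) \<beta> j i k l x y = 0"
    and xy: "x \<in> U" "y \<noteq> 0"
  obtains a where "\<And>i. cov13 (spray F') (berwald_curv F') j i k l x y = a * y $ i"
proof -
  let ?w = "\<lambda>j k. dy j (dy k P)"
  let ?s = "\<lambda>j k l x y. b j k l x y + dy j (dy k (dy l P)) x y"
  let ?D = "\<lambda>T i. cov13 (spray F) T j i k l x y"
  have "?D (berwald_curv F') i = ?D (\<lambda>j i k l x y. \<beta> j i k l x y + (?s j k l x y * y $ i
      + (?w k l x y * axis i 1 $ j + (?w j l x y * axis i 1 $ k + ?w j k x y * axis i 1 $ l)))) i"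
    for i
    by (rule cov13_cong[OF _ xy]) (simp add: berwald_curv_change B algebra_simps)
  also have "\<dots> i = ?D \<beta> i + (?D (\<lambda>j i k l x y. ?s j k l x y * y $ i) i
      + (?D (\<lambda>j i k l x y. ?w k l x y * axis i 1 $ j) i
      + (?D (\<lambda>j i k l x y. ?w j l x y * axis i 1 $ k) i
      + ?D (\<lambda>j i k l x y. ?w j k x y * axis i 1 $ l) i)))" for i
    using \<beta> b xy by (simp add: cov13_add)
  also have "\<dots> i = cov03 (spray F) ?s j k l x y * y $ i" for i
    using cov13_outer[of ?s "spray F" x y j i k l, OF _ old.homog_spray xy]
      cov13_delta[of ?w, OF _ xy, of "spray F"] cov02_hessian[OF Q xy] b
    by (simp add: \<beta>0)
  finally have 1: "?D (berwald_curv F') i = cov03 (spray F) ?s j k l x y * y $ i" for i .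
  have "cov13 (spray F') (berwald_curv F') j i k l x y = ?D (berwald_curv F') i
      + (\<Sum>r\<in>UNIV. berwald_curv F' j r k l x y * dy r P x y) * y $ i" for i
    by (intro cov13_projective old.sm_spray sm_P spray_change new.homog_berwald_curv
        new.berwald_curv_y xy)
  then show ?thesis
    using that[of "cov03 (spray F) ?s j k l x y
      + (\<Sum>r\<in>UNIV. berwald_curv F' j r k l x y * dy r P x y)"]
    unfolding 1 by (simp add: distrib_right)
qed

lemma berwald_cov_berwald_hor:
  assumes "\<And>i j x y. x \<in> U \<Longrightarrow> y \<noteq> 0 \<Longrightarrow> Q2 F P i j x y = 0"
    and "\<And>j i k l. sm (\<beta> j i k l)" and "\<And>j k l. sm (b j k l)"
    and "\<And>j i k l x y. x \<in> U \<Longrightarrow> y \<noteq> 0 \<Longrightarrow>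
      berwald_curv F j i k l x y = \<beta> j i k l x y + b j k l x y * y $ i"
    and \<beta>0: "\<And>j i k l. (\<Sum>m\<in>UNIV. berwald_cov F \<beta> j i k l m x y * y $ m) = 0"
    and xy: "x \<in> U" "y \<noteq> 0"
  shows "(\<Sum>m\<in>UNIV. berwald_cov F' (berwald_hor F') j i k l m x y * y $ m) = 0"
proof -
  obtain a where "\<And>i. cov13 (spray F') (berwald_curv F') j i k l x y = a * y $ i"
    using cov13_berwald_curv_change[OF assms(1-4) _ xy] \<beta>0 old.berwald_cov_spray[OF xy] by metis
  then show ?thesis
    unfolding new.berwald_cov_spray[OF xy] by (rule new.cov13_berwald_hor[OF _ xy])
qed

end

section \<open>Change of coordinates\<close>

definition pull1 :: "real ^ 'n ^ 'n \<Rightarrow> ('n::finite \<Rightarrow> real) \<Rightarrow> 'n \<Rightarrow> real" where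
  "pull1 J s j = (\<Sum>r\<in>UNIV. J $ r $ j * s r)"

text \<open>Built by nesting \<open>pull1\<close>, so that linearity and the derivative rule for one
  index carry over to several.\<close>

definition pull2 where
  "pull2 J s j k = pull1 J (\<lambda>r. pull1 J (s r) k) j"

definition pull3 where
  "pull3 J s j k l = pull1 J (\<lambda>r. pull2 J (s r) k l) j"

lemma pull1_add: "pull1 J (\<lambda>r. s r + t r) j = pull1 J s j + pull1 J t j"
  and pull1_diff: "pull1 J (\<lambda>r. s r - t r) j = pull1 J s j - pull1 J t j"
  and pull1_cmult: "pull1 J (\<lambda>r. c * s r) j = c * pull1 J s j"
  by (simp_all add: pull1_def algebra_simps sum.distrib sum_subtractf sum_distrib_left)

lemma pull1_axis: "pull1 J (\<lambda>r. axis i 1 $ r) j = J $ i $ j"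
  by (simp add: pull1_def sum_axis)

lemma pull1_sum: "pull1 J (\<lambda>r. \<Sum>a\<in>I. s a r) j = (\<Sum>a\<in>I. pull1 J (s a) j)"
  unfolding pull1_def sum_distrib_left by (rule sum.swap)

lemmas pull_linear = pull1_add pull1_diff pull1_cmult pull1_axis pull1_sum

text \<open>The tensor law at a single point, for bare arrays of components: \<open>J\<close> acts
  on the lower indices and \<open>K\<close>, in the application the inverse Jacobian, on the upper
  one.\<close>

definition transforms13 where
  "transforms13 J K T T' \<longleftrightarrow>
     (\<forall>j i k l. T j i k l = (\<Sum>a\<in>UNIV. K $ i $ a * pull3 J (\<lambda>b d e. T' b a d e) j k l))"

lemma pull3_eq:
  "pull3 J s j k l = (\<Sum>r\<in>UNIV. \<Sum>d\<in>UNIV. \<Sum>e\<in>UNIV. s r d e * J $ r $ j * J $ d $ k * J $ e $ l)"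
  unfolding pull3_def pull2_def pull1_def by (simp add: sum_distrib_left mult_ac)

lemma transforms13_iff:
  "transforms13 J K T T' \<longleftrightarrow> (\<forall>j i k l. T j i k l = (\<Sum>b\<in>UNIV. \<Sum>a\<in>UNIV. \<Sum>d\<in>UNIV. \<Sum>e\<in>UNIV.
     K $ i $ a * T' b a d e * J $ b $ j * J $ d $ k * J $ e $ l))"
  unfolding transforms13_def pull3_eq sum_distrib_left
  by (subst sum.swap) (simp add: mult_ac)

lemma transforms13_add:
  "transforms13 J K S S' \<Longrightarrow> transforms13 J K T T' \<Longrightarrow>
    transforms13 J K (\<lambda>j i k l. S j i k l + T j i k l) (\<lambda>j i k l. S' j i k l + T' j i k l)"
  by (simp add: transforms13_def pull3_def pull2_def pull_linear distrib_left sum.distrib)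

lemma transforms13_diff:
  "transforms13 J K S S' \<Longrightarrow> transforms13 J K T T' \<Longrightarrow>
    transforms13 J K (\<lambda>j i k l. S j i k l - T j i k l) (\<lambda>j i k l. S' j i k l - T' j i k l)"
  by (simp add: transforms13_def pull3_def pull2_def pull_linear right_diff_distrib sum_subtractf)

lemma transforms13_outer:
  assumes "\<And>j k l. s j k l = pull3 J s' j k l" "K *v y' = y"
  shows "transforms13 J K (\<lambda>j i k l. s j k l * y $ i) (\<lambda>j i k l. s' j k l * y' $ i)"
proof -
  have "y $ i = (\<Sum>a\<in>UNIV. K $ i $ a * y' $ a)" for i
    using assms(2) by (auto simp: matrix_vector_mult_def)
  then show ?thesis
    unfolding transforms13_def
    by (simp add: pull3_def pull2_def pull_linear assms(1) mult.commute[of _ "y' $ _"]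
        sum_distrib_left sum_distrib_right mult_ac)
qed

lemma transforms13_delta:
  assumes KJ: "K ** J = mat 1" and w: "\<And>j k. w j k = pull2 J w' j k"
  shows "transforms13 J K (\<lambda>j i k l. w j k * axis i 1 $ l) (\<lambda>j i k l. w' j k * axis i 1 $ l)"
    and "transforms13 J K (\<lambda>j i k l. w j l * axis i 1 $ k) (\<lambda>j i k l. w' j l * axis i 1 $ k)"
    and "transforms13 J K (\<lambda>j i k l. w k l * axis i 1 $ j) (\<lambda>j i k l. w' k l * axis i 1 $ j)"
proof -
  have "(\<Sum>a\<in>UNIV. K $ i $ a * J $ a $ l) = axis i 1 $ l" for i l
    using arg_cong[OF KJ, of "\<lambda>M. M $ i $ l"]
    by (simp add: matrix_matrix_mult_def mat_def axis_def eq_commute[of l])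
  then have *: "(\<Sum>a\<in>UNIV. K $ i $ a * (c * J $ a $ l)) = c * axis i 1 $ l" for i l c
    by (simp add: mult.left_commute flip: sum_distrib_left)
  have **: "(\<Sum>a\<in>UNIV. K $ i $ a * (J $ a $ l * c)) = c * axis i 1 $ l" for i l c
    using *[of i c l] by (simp add: mult.commute)
  have c: "pull1 J (\<lambda>r. s r * c) j = c * pull1 J s j" for s c j
    using pull1_cmult[of J c s j] by (simp add: mult.commute)
  show "transforms13 J K (\<lambda>j i k l. w j k * axis i 1 $ l) (\<lambda>j i k l. w' j k * axis i 1 $ l)"
    unfolding transforms13_def pull3_def pull2_def w
    by (simp add: pull_linear c * ** mult.commute[of "axis _ _ $ _"] flip: pull2_def)
  show "transforms13 J K (\<lambda>j i k l. w j l * axis i 1 $ k) (\<lambda>j i k l. w' j l * axis i 1 $ k)"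
    unfolding transforms13_def pull3_def pull2_def w
    by (simp add: pull_linear c * ** mult.commute[of "axis _ _ $ _"] flip: pull2_def)
  show "transforms13 J K (\<lambda>j i k l. w k l * axis i 1 $ j) (\<lambda>j i k l. w' k l * axis i 1 $ j)"
    unfolding transforms13_def pull3_def pull2_def w
    by (simp add: pull_linear c * ** mult.commute[of "axis _ _ $ _"] flip: pull2_def)
qed

text \<open>In the contracted pair of indices \<open>J\<close> meets \<open>K\<close>, and their
  product is the identity; only the three lower indices still transform.\<close>

lemma transforms13_contract:
  assumes JK: "J ** K = mat 1" and T: "transforms13 J K T T'" and a: "\<And>r. a r = pull1 J a' r"
  shows "(\<Sum>r\<in>UNIV. a r * T j r k l) = pull3 J (\<lambda>j k l. \<Sum>r\<in>UNIV. a' r * T' j r k l) j k l"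
proof -
  let ?p = "\<lambda>a. pull3 J (\<lambda>b d e. T' b a d e) j k l"
  have *: "(\<Sum>r\<in>UNIV. J $ c $ r * K $ r $ d) = axis c 1 $ d" for c d
    using arg_cong[OF JK, of "\<lambda>M. M $ c $ d"]
    by (simp add: matrix_matrix_mult_def mat_def axis_def eq_commute[of d])
  have "(\<Sum>r\<in>UNIV. a r * T j r k l)
      = (\<Sum>r\<in>UNIV. \<Sum>c\<in>UNIV. \<Sum>d\<in>UNIV. a' c * ?p d * (J $ c $ r * K $ r $ d))"
    using T unfolding a transforms13_def pull1_def
    by (simp add: sum_product mult_ac)
  also have "\<dots> = (\<Sum>c\<in>UNIV. \<Sum>d\<in>UNIV. a' c * ?p d * (\<Sum>r\<in>UNIV. J $ c $ r * K $ r $ d))"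
    by (subst sum.swap, rule sum.cong[OF refl], subst sum.swap) (simp add: sum_distrib_left)
  also have "\<dots> = (\<Sum>c\<in>UNIV. a' c * ?p c)"
    unfolding * by (simp add: sum_axis mult.assoc flip: sum_distrib_left)
  finally show ?thesis by (simp add: pull3_def pull2_def pull_linear)
qed

context slit_chart
begin

text \<open>The chain rule for the linear map \<open>y \<mapsto> J y\<close> between two fibres. The
  base points stay fixed, so no derivative of the Jacobian appears.\<close>

lemma dy_linear_pullback:
  assumes g: "sm g" and fg: "\<And>z. z \<noteq> 0 \<Longrightarrow> f x z = g x' (J *v z)"
    and xy: "x' \<in> U" "y \<noteq> 0" "J *v y \<noteq> 0"
  shows "dy i f x y = pull1 J (\<lambda>a. dy a g x' (J *v y)) i"
proof -
  let ?D = "frechet_derivative (\<lambda>z. g (fst z) (snd z)) (at (x', J *v y))"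
  let ?v = "J *v axis i 1"
  have lin: "linear ?D"
    by (rule linear_frechet_derivative[OF sm_differentiable[OF g xy(1,3)]])
  have "((\<lambda>t. y + t *\<^sub>R axis i 1) \<longlongrightarrow> y + 0 *\<^sub>R axis i 1) (nhds 0)"
    by (intro tendsto_intros filterlim_ident)
  then have "\<forall>\<^sub>F t in nhds 0. y + t *\<^sub>R axis i (1::real) \<in> - {0}"
    by (intro topological_tendstoD) (use xy in \<open>auto simp: open_Compl\<close>)
  then have "\<forall>\<^sub>F t in nhds 0. f x (y + t *\<^sub>R axis i 1) = g x' (J *v y + t *\<^sub>R ?v)"
    by eventually_elim (simp add: fg matrix_vector_right_distrib matrix_vector_mult_scaleR)
  then have "dy i f x y = pd (0, ?v) g x' (J *v y)"
    unfolding dy_def pd_def by (simp add: deriv_cong_ev)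
  also have "\<dots> = ?D (0, ?v)" by (rule pd_eq_frechet[OF g xy(1,3)])
  also have "(0, ?v) = (\<Sum>a\<in>UNIV. J $ a $ i *\<^sub>R (0, axis a 1))"
  proof -
    have "?v = (\<Sum>a\<in>UNIV. J $ a $ i *\<^sub>R axis a 1)"
      by (simp add: vec_eq_iff matrix_vector_mult_basis column_def sum_axis)
    then show ?thesis by (simp add: prod_eq_iff fst_sum snd_sum)
  qed
  also have "?D \<dots> = (\<Sum>a\<in>UNIV. J $ a $ i * ?D (0, axis a 1))"
    using lin by (simp add: linear_sum linear_cmul del: scaleR_Pair)
  finally show ?thesis
    by (simp add: pull1_def dy_pd pd_eq_frechet[OF g xy(1,3)])
qed

lemma sm_pull1: "(\<And>a. sm (g a)) \<Longrightarrow> sm (\<lambda>x y. pull1 J (\<lambda>a. g a x y) i)"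
  unfolding pull1_def by (intro sm_sum sm_mult sm_const)

lemma dy_pull1:
  "(\<And>a. sm (g a)) \<Longrightarrow> x \<in> U \<Longrightarrow> y \<noteq> 0 \<Longrightarrow>
    dy b (\<lambda>x y. pull1 J (\<lambda>a. g a x y) i) x y = pull1 J (\<lambda>a. dy b (g a) x y) i"
  unfolding pull1_def by (simp add: d_rules)

lemma dy_linear_pullback_iterated:
  assumes g: "sm g" and fg: "\<And>z. z \<noteq> 0 \<Longrightarrow> f x z = g x' (J *v z)"
    and x': "x' \<in> U" and J: "\<And>z. z \<noteq> 0 \<Longrightarrow> J *v z \<noteq> 0" and y: "y \<noteq> 0"
  shows "dy j (dy k f) x y = pull2 J (\<lambda>a b. dy a (dy b g) x' (J *v y)) j k"
    and "dy j (dy k (dy l f)) x y = pull3 J (\<lambda>a b c. dy a (dy b (dy c g)) x' (J *v y)) j k l"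
proof -
  have 1: "dy l f x z = (\<lambda>x y. pull1 J (\<lambda>a. dy a g x y) l) x' (J *v z)" if "z \<noteq> 0" for z l
    by (rule dy_linear_pullback[of g f, OF g fg x' that J[OF that]])
  have 2: "dy k (dy l f) x z
      = (\<lambda>x y. pull1 J (\<lambda>a. pull1 J (\<lambda>b. dy a (dy b g) x y) l) k) x' (J *v z)" if "z \<noteq> 0" for z k l
    using dy_linear_pullback[of "\<lambda>x y. pull1 J (\<lambda>a. dy a g x y) l" "dy l f",
        OF sm_pull1 1 x' that J[OF that]] g x' J[OF that]
    by (simp add: dy_pull1)
  show "dy j (dy k f) x y = pull2 J (\<lambda>a b. dy a (dy b g) x' (J *v y)) j k"
    using 2[OF y] by (simp add: pull2_def)
  show "dy j (dy k (dy l f)) x y = pull3 J (\<lambda>a b c. dy a (dy b (dy c g)) x' (J *v y)) j k l"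
    using dy_linear_pullback[of "\<lambda>x y. pull1 J (\<lambda>a. pull1 J (\<lambda>b. dy a (dy b g) x y) l) k"
        "dy k (dy l f)", OF sm_pull1[OF sm_pull1] 2 x' y J[OF y]] g x' J[OF y]
    by (simp add: dy_pull1 sm_pull1 pull3_def pull2_def)
qed

lemma homogI:
  assumes f: "sm f" and h: "\<And>x y a. x \<in> U \<Longrightarrow> y \<noteq> 0 \<Longrightarrow> a > 0 \<Longrightarrow> f x (a *\<^sub>R y) = a ^ n * f x y"
  shows "homog (real n) f"
  unfolding homog_def euler_op_def
proof (intro ballI allI impI)
  fix x y assume xy: "x \<in> U" "y \<noteq> (0 :: real ^ 'n)"
  let ?D = "frechet_derivative (\<lambda>z. f (fst z) (snd z)) (at (x, y))"
  have lin: "linear ?D"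
    by (rule linear_frechet_derivative[OF sm_differentiable[OF f xy]])
  have "(\<Sum>r\<in>UNIV. y $ r * dy r f x y) = ?D (\<Sum>r\<in>UNIV. y $ r *\<^sub>R (0, axis r 1))"
    using lin by (simp add: linear_sum linear_cmul dy_pd pd_eq_frechet[OF f xy] del: scaleR_Pair)
  also have "(\<Sum>r\<in>UNIV. y $ r *\<^sub>R (0, axis r 1)) = (0 :: real ^ 'n, y)"
    by (simp add: prod_eq_iff fst_sum snd_sum vec_eq_iff sum_axis)
  also have "?D (0, y) = pd (0, y) f x y" by (rule pd_eq_frechet[OF f xy, symmetric])
  also have "\<dots> = deriv (\<lambda>t. (1 + t) ^ n * f x y) 0"
    unfolding pd_def
  proof (rule deriv_cong_ev)
    \<comment> \<open>For \<open>t > -1\<close> the scaling factor \<open>1 + t\<close> is positive,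
      so the scaling law applies to \<open>y + t y\<close>.\<close>
    have "\<forall>\<^sub>F t in nhds (0::real). t \<in> {-1<..}"
      by (rule eventually_nhds_in_open) auto
    then show "\<forall>\<^sub>F t in nhds 0. f (x + t *\<^sub>R fst (0, y)) (y + t *\<^sub>R snd (0, y)) = (1 + t) ^ n * f x y"
      by eventually_elim (use h[OF xy] in \<open>simp add: scaleR_left_distrib[of 1, simplified, symmetric]\<close>)
  qed simp
  also have "\<dots> = real n * f x y"
    by (rule DERIV_imp_deriv) (auto intro!: derivative_eq_intros)
  finally show "(\<Sum>r\<in>UNIV. y $ r * dy r f x y) = real n * f x y" .
qed

end

section \<open>Atlases\<close>

locale atlas =
  fixes M :: "'m topology" and A :: "('m, 'n::finite) chart set"
  assumes smooth_manifold: "smooth_manifold M A"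
begin

section \<open>Charts and the Jacobians of coordinate changes\<close>

definition jac :: "('m, 'n) chart \<Rightarrow> ('m, 'n) chart \<Rightarrow> 'm \<Rightarrow> real ^ 'n ^ 'n" where
  "jac c c' p = jacobian (transition c c') (at (snd c p))"

lemma is_chart: "c \<in> A \<Longrightarrow> is_chart M c"
  using smooth_manifold by (simp add: smooth_manifold_def)

lemma open_chart_image: "c \<in> A \<Longrightarrow> open (chart_image c)"
  using is_chart by (simp add: is_chart_def)

lemma openin_chart: "c \<in> A \<Longrightarrow> openin M (fst c)"
  using is_chart by (simp add: is_chart_def)

lemma chart_subset: "c \<in> A \<Longrightarrow> fst c \<subseteq> topspace M"
  by (rule openin_subset[OF openin_chart])

lemma inj_chart:
  assumes "c \<in> A" shows "inj_on (snd c) (fst c)"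
proof -
  have "inj_on (snd c) (topspace (subtopology M (fst c)))"
    using is_chart[OF assms] homeomorphic_imp_injective_map unfolding is_chart_def by blast
  then show ?thesis using chart_subset[OF assms] by (simp add: Int_absorb1)
qed

lemma chart_inv_chart: "c \<in> A \<Longrightarrow> p \<in> fst c \<Longrightarrow> chart_inv c (snd c p) = p"
  using inj_chart by (simp add: chart_inv_def)

lemma chart_inv_in: "x \<in> chart_image c \<Longrightarrow> chart_inv c x \<in> fst c"
  by (simp add: chart_inv_def chart_image_def inv_into_into)

lemma transition_chart: "c \<in> A \<Longrightarrow> p \<in> fst c \<Longrightarrow> transition c c' (snd c p) = snd c' p"
  by (simp add: transition_def chart_inv_chart)

lemma open_chart_overlap:
  assumes c: "c \<in> A" and V: "openin M V" shows "open (snd c ` (fst c \<inter> V))"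
proof -
  have "open_map (subtopology M (fst c)) (top_of_set (chart_image c)) (snd c)"
    using is_chart[OF c] homeomorphic_imp_open_map unfolding is_chart_def by blast
  moreover have "openin (subtopology M (fst c)) (fst c \<inter> V)"
    using V by (rule openin_subtopology_Int2)
  ultimately have "openin (top_of_set (chart_image c)) (snd c ` (fst c \<inter> V))"
    by (simp add: open_map_def)
  then show ?thesis using open_chart_image[OF c] openin_open_trans by blast
qed

lemma transition_has_derivative:
  assumes "c \<in> A" "c' \<in> A" "p \<in> fst c" "p \<in> fst c'"
  shows "(transition c c' has_derivative (*v) (jac c c' p)) (at (snd c p))"
proof -
  have "smooth_on (snd c ` (fst c \<inter> fst c')) (transition c c')"
    using smooth_manifold assms by (simp add: smooth_manifold_def)
  then have "transition c c' differentiable at (snd c p)"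
    using assms by (intro smooth_on_imp_differentiable) auto
  then show ?thesis by (simp add: jac_def jacobian_works)
qed

lemma jac_unique:
  fixes J J' :: "real ^ 'a ^ 'b"
  assumes "(f has_derivative (*v) J) (at x)" "(f has_derivative (*v) J') (at x)"
  shows "J = J'"
  using arg_cong[OF has_derivative_unique[OF assms], of matrix] by simp

text \<open>The cocycle identity: the chain rule together with the uniqueness of derivatives. The
  composite and the direct transition agree on the open image of the overlap of \<open>c\<close> and
  \<open>c'\<close>.\<close>

lemma jac_trans:
  assumes c: "c \<in> A" "c' \<in> A" "c'' \<in> A" and p: "p \<in> fst c" "p \<in> fst c'" "p \<in> fst c''"
  shows "jac c c'' p = jac c' c'' p ** jac c c' p"
proof (rule jac_unique)
  show "(transition c c'' has_derivative (*v) (jac c c'' p)) (at (snd c p))"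
    by (rule transition_has_derivative[OF c(1,3) p(1,3)])
  have "(transition c' c'' \<circ> transition c c' has_derivative (*v) (jac c' c'' p) \<circ> (*v) (jac c c' p))
      (at (snd c p))"
    using transition_has_derivative[OF c(1,2) p(1,2)] transition_has_derivative[OF c(2,3) p(2,3)]
    by (intro diff_chain_at) (simp_all add: transition_chart c p)
  then have "(transition c' c'' \<circ> transition c c' has_derivative (*v) (jac c' c'' p ** jac c c' p))
      (at (snd c p))"
    by (simp add: o_def matrix_vector_mul_assoc)
  then show "(transition c c'' has_derivative (*v) (jac c' c'' p ** jac c c' p)) (at (snd c p))"
  proof (rule has_derivative_transform_within_open)
    show "open (snd c ` (fst c \<inter> fst c'))"
      by (rule open_chart_overlap[OF c(1) openin_chart[OF c(2)]])
    show "snd c p \<in> snd c ` (fst c \<inter> fst c')" using p by simp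
    show "(transition c' c'' \<circ> transition c c') x = transition c c'' x"
      if "x \<in> snd c ` (fst c \<inter> fst c')" for x
      using that c by (auto simp: transition_chart)
  qed
qed

lemma jac_refl:
  assumes c: "c \<in> A" and p: "p \<in> fst c" shows "jac c c p = mat 1"
proof (rule jac_unique)
  show "(transition c c has_derivative (*v) (jac c c p)) (at (snd c p))"
    by (rule transition_has_derivative[OF c c p p])
  have "((\<lambda>x. x) has_derivative (*v) (mat 1)) (at (snd c p))"
    by (rule has_derivative_eq_rhs[OF has_derivative_ident]) (simp add: fun_eq_iff)
  then show "(transition c c has_derivative (*v) (mat 1)) (at (snd c p))"
    by (rule has_derivative_transform_within_open[OF _ open_chart_image[OF c]])
      (use p c in \<open>auto simp: chart_image_def transition_chart\<close>)
qed

lemma jac_inverse: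
  assumes "c \<in> A" "c' \<in> A" "p \<in> fst c" "p \<in> fst c'"
  shows "jac c' c p ** jac c c' p = mat 1"
  using jac_trans[of c c' c p] jac_refl assms by simp

lemma jac_nonzero:
  assumes "c \<in> A" "c' \<in> A" "p \<in> fst c" "p \<in> fst c'" "y \<noteq> 0"
  shows "jac c c' p *v y \<noteq> 0"
proof
  assume "jac c c' p *v y = 0"
  then have "(jac c' c p ** jac c c' p) *v y = 0"
    by (simp flip: matrix_vector_mul_assoc)
  then show False using jac_inverse[OF assms(1-4)] assms(5) by simp
qed

section \<open>Tangent vectors and functions in coordinates\<close>

lemma tvec_of_apply: "c' \<in> A \<Longrightarrow> p \<in> fst c' \<Longrightarrow> tvec_of A c p y c' = jac c c' p *v y"
  by (simp add: tvec_of_def jac_def)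

lemma tvec_of_tangent:
  assumes "c \<in> A" "p \<in> fst c" shows "tvec_of A c p y \<in> tangent_space A p"
  unfolding tangent_space_def
proof (intro CollectI conjI allI ballI impI)
  fix c1 c2 assume *: "c1 \<in> A" "c2 \<in> A" "p \<in> fst c1 \<inter> fst c2"
  then show "tvec_of A c p y c2
      = jacobian (transition c1 c2) (at (snd c1 p)) *v tvec_of A c p y c1"
    using jac_trans[of c c1 c2 p] assms
    by (simp add: tvec_of_apply matrix_vector_mul_assoc flip: jac_def)
qed (auto simp: tvec_of_def)

lemma tvec_of_scale: "tvec_of A c p (a *\<^sub>R y) = tscale a (tvec_of A c p y)"
  by (simp add: tvec_of_def tscale_def fun_eq_iff matrix_vector_mult_scaleR)

lemma tvec_of_nonzero: "c \<in> A \<Longrightarrow> p \<in> fst c \<Longrightarrow> y \<noteq> 0 \<Longrightarrow> tvec_of A c p y \<noteq> tzero"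
  using tvec_of_apply[of c p c y] by (auto simp: jac_refl tzero_def)

lemma tvec_of_tangent_bundle:
  "c \<in> A \<Longrightarrow> x \<in> chart_image c \<Longrightarrow> (chart_inv c x, tvec_of A c (chart_inv c x) y) \<in> tangent_bundle M A"
  using chart_subset[of c] chart_inv_in[of x c] tvec_of_tangent[of c "chart_inv c x" y]
  by (auto simp: tangent_bundle_def)

text \<open>By the cocycle identity, \<open>y\<close> in \<open>c\<close> and its image under the
  Jacobian in \<open>c'\<close> describe the same tangent vector.\<close>

lemma local_expr_change:
  assumes c: "c \<in> A" "c' \<in> A" and p: "p \<in> fst c" "p \<in> fst c'"
  shows "local_expr A c f (snd c p) y = local_expr A c' f (snd c' p) (jac c c' p *v y)"
proof -
  have "tvec_of A c p y c'' = tvec_of A c' p (jac c c' p *v y) c''" for c''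
  proof (cases "c'' \<in> A \<and> p \<in> fst c''")
    case True
    then show ?thesis
      using jac_trans[of c c' c'' p] assms by (simp add: tvec_of_apply matrix_vector_mul_assoc)
  qed (auto simp: tvec_of_def)
  then have "tvec_of A c p y = tvec_of A c' p (jac c c' p *v y)" by (rule ext)
  then show ?thesis
    using assms by (simp add: local_expr_def chart_inv_chart)
qed

lemma slit_chart: "c \<in> A \<Longrightarrow> slit_chart (chart_image c)"
  by (simp add: slit_chart_def open_chart_image)

lemma smooth_comp_sm: "c \<in> A \<Longrightarrow> smooth_comp c f \<longleftrightarrow> slit_chart.sm (chart_image c) f"
  using slit_chart by (simp add: smooth_comp_def slit_chart.sm_def)

lemma finsler_chart:
  assumes F: "finsler_metric M A F" and c: "c \<in> A"
  shows "finsler_chart (chart_image c) (local_expr A c F)"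
proof -
  let ?F = "local_expr A c F"
  interpret slit_chart "chart_image c" by (rule slit_chart[OF c])
  have "sm ?F"
    using F c smooth_comp_sm by (auto simp: finsler_metric_def smooth_slit_def)
  then have sm: "sm (fsq ?F)"
    unfolding fsq_def[abs_def] power2_eq_square by simp
  have "?F x (a *\<^sub>R y) = a * ?F x y" if "x \<in> chart_image c" "a > 0" for x y a
    using F that tvec_of_tangent_bundle[OF c that(1), of y]
    by (auto simp: finsler_metric_def local_expr_def tvec_of_scale)
  then have "homog (real 2) (fsq ?F)"
    by (intro homogI sm) (simp add: fsq_def power_mult_distrib)
  moreover have "\<xi> \<bullet> (fund_tensor ?F x y *v \<xi>) > 0"
    if "x \<in> chart_image c" "y \<noteq> 0" "\<xi> \<noteq> 0" for x y \<xi>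
    using F c that by (auto simp: finsler_metric_def)
  ultimately show ?thesis
    using sm by unfold_locales auto
qed

lemma projective_charts:
  assumes "finsler_metric M A F" "finsler_metric M A F'" "projective_change M A F F' P" "c \<in> A"
  shows "projective_charts (chart_image c) (local_expr A c F) (local_expr A c F') (local_expr A c P)"
proof -
  let ?P = "local_expr A c P"
  interpret old: finsler_chart "chart_image c" "local_expr A c F"
    by (rule finsler_chart[OF assms(1,4)])
  interpret new: finsler_chart "chart_image c" "local_expr A c F'"
    by (rule finsler_chart[OF assms(2,4)])
  have sm: "old.sm ?P"
    using assms(3,4) smooth_comp_sm by (auto simp: projective_change_def smooth_slit_def)
  have "?P x (a *\<^sub>R y) = a * ?P x y" if "x \<in> chart_image c" "y \<noteq> 0" "a > 0" for x y a
    using assms(3,4) that tvec_of_tangent_bundle[of c x y] tvec_of_nonzero[of c "chart_inv c x" y]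
      chart_inv_in[of x c]
    by (auto simp: projective_change_def local_expr_def tvec_of_scale slit_tangent_bundle_def)
  then have "old.homog (real 1) ?P"
    by (intro old.homogI sm) simp
  then show ?thesis
    using sm assms(3,4) by unfold_locales (auto simp: projective_change_def)
qed

lemma tensor_field_13_iff:
  "tensor_field_13 A T \<longleftrightarrow> (\<forall>c\<in>A. \<forall>j i k l. smooth_comp c (T c j i k l)) \<and>
     (\<forall>c\<in>A. \<forall>c'\<in>A. \<forall>p\<in>fst c \<inter> fst c'. \<forall>y. y \<noteq> 0 \<longrightarrow>
        transforms13 (jac c c' p) (jac c' c p) (\<lambda>j i k l. T c j i k l (snd c p) y)
          (\<lambda>j i k l. T c' j i k l (snd c' p) (jac c c' p *v y)))"
  unfolding tensor_field_13_def transforms13_iff jac_def Let_def by (rule refl)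

lemma tensor_field_03_iff:
  "tensor_field_03 A T \<longleftrightarrow> (\<forall>c\<in>A. \<forall>j k l. smooth_comp c (T c j k l)) \<and>
     (\<forall>c\<in>A. \<forall>c'\<in>A. \<forall>p\<in>fst c \<inter> fst c'. \<forall>y. y \<noteq> 0 \<longrightarrow> (\<forall>j k l.
        T c j k l (snd c p) y =
          pull3 (jac c c' p) (\<lambda>j k l. T c' j k l (snd c' p) (jac c c' p *v y)) j k l))"
  unfolding tensor_field_03_def pull3_eq jac_def Let_def by (rule refl)

end

theorem theorem1p2:
  fixes M :: "'m topology" and A :: "('m, 'n::finite) chart set"
    and F F' :: "'m \<times> ('m, 'n) tvec \<Rightarrow> real"
  assumes "smooth_manifold M A"
    and "finsler_metric M A F" and "finsler_metric M A F'"
    and "GBW_metric M A F"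
    and "C_projective_change M A F F'"
  shows "GBW_metric M A F'"
proof -
  interpret atlas M A by (rule atlas.intro[OF assms(1)])
  obtain \<beta> b where \<beta>: "tensor_field_13 A \<beta>" and b: "tensor_field_03 A b"
    and B: "\<And>c x y j i k l. c \<in> A \<Longrightarrow> x \<in> chart_image c \<Longrightarrow> y \<noteq> 0 \<Longrightarrow>
      berwald_curv (local_expr A c F) j i k l x y = \<beta> c j i k l x y + b c j k l x y * y $ i"
    and \<beta>0: "\<And>c x y j i k l. c \<in> A \<Longrightarrow> x \<in> chart_image c \<Longrightarrow> y \<noteq> 0 \<Longrightarrow>
      (\<Sum>m\<in>UNIV. berwald_cov (local_expr A c F) (\<beta> c) j i k l m x y * y $ m) = 0"
    using assms(4) unfolding GBW_metric_def by blast
  obtain P where P: "projective_change M A F F' P"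
    and Q: "\<And>c x y i j. c \<in> A \<Longrightarrow> x \<in> chart_image c \<Longrightarrow> y \<noteq> 0 \<Longrightarrow>
      Q2 (local_expr A c F) (local_expr A c P) i j x y = 0"
    using assms(5) unfolding C_projective_change_def by blast
  let ?F' = "\<lambda>c. local_expr A c F'" and ?P = "\<lambda>c. local_expr A c P"
  note charts = projective_charts[OF assms(2,3) P]
  have curv: "transforms13 (jac c c' p) (jac c' c p)
      (\<lambda>j i k l. berwald_curv (?F' c) j i k l (snd c p) y)
      (\<lambda>j i k l. berwald_curv (?F' c') j i k l (snd c' p) (jac c c' p *v y))"
    and vert: "\<And>j k l. berwald_vert (?F' c) j k l (snd c p) y = pull3 (jac c c' p)
      (\<lambda>j k l. berwald_vert (?F' c') j k l (snd c' p) (jac c c' p *v y)) j k l"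
    and y: "jac c' c p *v (jac c c' p *v y) = y"
    if c: "c \<in> A" "c' \<in> A" "p \<in> fst c" "p \<in> fst c'" and y: "y \<noteq> 0" for c c' p y
  proof -
    interpret C: projective_charts "chart_image c" "local_expr A c F" "?F' c" "?P c"
      by (rule charts[OF c(1)])
    interpret C': projective_charts "chart_image c'" "local_expr A c' F" "?F' c'" "?P c'"
      by (rule charts[OF c(2)])
    let ?J = "jac c c' p" and ?K = "jac c' c p"
    let ?x = "snd c p" and ?x' = "snd c' p" and ?y = "?J *v y"
    have x: "?x \<in> chart_image c" "?x' \<in> chart_image c'" using c by (auto simp: chart_image_def)
    have J: "?J *v z \<noteq> 0" if "z \<noteq> 0" for z by (rule jac_nonzero[OF c that])
    have KJ: "?K ** ?J = mat 1" and JK: "?J ** ?K = mat 1" using jac_inverse c by auto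
    show yy: "?K *v ?y = y" by (simp add: matrix_vector_mul_assoc KJ)
    \<comment> \<open>Since \<open>P\<close> is a function on the slit bundle, its second and third
      vertical derivatives transform as covariant tensors.\<close>
    note P2 = C'.dy_linear_pullback_iterated[of "?P c'" "?P c" ?x ?x' ?J y,
        OF C'.sm_P local_expr_change[OF c] x(2) J y]
    have "transforms13 ?J ?K (\<lambda>j i k l. \<beta> c j i k l ?x y) (\<lambda>j i k l. \<beta> c' j i k l ?x' ?y)"
      using \<beta> c y by (simp add: tensor_field_13_iff)
    moreover have "b c j k l ?x y = pull3 ?J (\<lambda>j k l. b c' j k l ?x' ?y) j k l" for j k l
      using b c y unfolding tensor_field_03_iff by blast
    then have "transforms13 ?J ?K (\<lambda>j i k l. b c j k l ?x y * y $ i)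
        (\<lambda>j i k l. b c' j k l ?x' ?y * ?y $ i)"
      by (intro transforms13_outer yy)
    moreover have "transforms13 ?J ?K (\<lambda>j i k l. dy j (dy k (dy l (?P c))) ?x y * y $ i)
        (\<lambda>j i k l. dy j (dy k (dy l (?P c'))) ?x' ?y * ?y $ i)"
      by (intro transforms13_outer yy) (rule P2(2))
    moreover note transforms13_delta[OF KJ P2(1)]
    ultimately show curv: "transforms13 ?J ?K (\<lambda>j i k l. berwald_curv (?F' c) j i k l ?x y)
      (\<lambda>j i k l. berwald_curv (?F' c') j i k l ?x' ?y)"
      unfolding C.berwald_curv_change[OF x(1) y] C'.berwald_curv_change[OF x(2) J[OF y]]
        B[OF c(1) x(1) y] B[OF c(2) x(2) J[OF y]]
      by (intro transforms13_add)
    \<comment> \<open>Invariance of the squared metric makes \<open>ly\<close> a covector, so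
      contracting the curvature with it again gives a tensor.\<close>
    have L: "fsq (?F' c) ?x z = fsq (?F' c') ?x' (?J *v z)" for z
      unfolding fsq_def local_expr_change[OF c] ..
    have "ly (?F' c) r ?x y = pull1 ?J (\<lambda>a. ly (?F' c') a ?x' ?y) r" for r
      unfolding ly_def L
        C'.dy_linear_pullback[of "fsq (?F' c')" "fsq (?F' c)" ?x ?x' ?J y,
          OF C'.new.sm_fsq L x(2) y J[OF y]]
      by (simp add: pull1_def sum_divide_distrib)
    then show "berwald_vert (?F' c) j k l ?x y
        = pull3 ?J (\<lambda>j k l. berwald_vert (?F' c') j k l ?x' ?y) j k l" for j k l
      unfolding berwald_vert_def by (rule transforms13_contract[OF JK curv])
  qed
  have sm: "smooth_comp c (berwald_hor (?F' c) j i k l)" "smooth_comp c (berwald_vert (?F' c) j k l)"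
    if "c \<in> A" for c j i k l
  proof -
    interpret C: projective_charts "chart_image c" "local_expr A c F" "?F' c" "?P c"
      by (rule charts[OF that])
    show "smooth_comp c (berwald_hor (?F' c) j i k l)" "smooth_comp c (berwald_vert (?F' c) j k l)"
      using smooth_comp_sm[OF that] by simp_all
  qed
  have "transforms13 (jac c c' p) (jac c' c p)
      (\<lambda>j i k l. berwald_hor (?F' c) j i k l (snd c p) y)
      (\<lambda>j i k l. berwald_hor (?F' c') j i k l (snd c' p) (jac c c' p *v y))"
    if c: "c \<in> A" "c' \<in> A" "p \<in> fst c" "p \<in> fst c'" and y0: "y \<noteq> 0" for c c' p y
    unfolding berwald_hor_def
    by (intro transforms13_diff transforms13_outer curv[OF c y0] vert[OF c y0] y[OF c y0])
  then have hor13: "tensor_field_13 A (\<lambda>c. berwald_hor (?F' c))"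
    using sm by (simp add: tensor_field_13_iff)
  have vert03: "tensor_field_03 A (\<lambda>c. berwald_vert (?F' c))"
    using sm vert by (simp add: tensor_field_03_iff)
  have parallel: "(\<Sum>m\<in>UNIV. berwald_cov (?F' c) (berwald_hor (?F' c)) j i k l m x y * y $ m) = 0"
    if c: "c \<in> A" and xy: "x \<in> chart_image c" "y \<noteq> 0" for c x y j i k l
  proof -
    interpret C: projective_charts "chart_image c" "local_expr A c F" "?F' c" "?P c"
      by (rule charts[OF c])
    have "C.sm (\<beta> c j i k l)" "C.sm (b c j k l)" for j i k l
      using \<beta> b c smooth_comp_sm[OF c] by (auto simp: tensor_field_13_def tensor_field_03_def)
    then show ?thesis
      by (intro C.berwald_cov_berwald_hor[OF Q[OF c] _ _ B[OF c] \<beta>0[OF c xy] xy])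
  qed
  show ?thesis
    unfolding GBW_metric_def
  proof (intro conjI exI ballI allI impI)
    \<comment> \<open>The witnesses are \<open>berwald_hor\<close> for \<open>\<beta>\<close> and
      \<open>berwald_vert\<close> for \<open>b\<close> in every chart; for these the decomposition
      holds by definition.\<close>
    show "berwald_curv (?F' c) j i k l x y
        = berwald_hor (?F' c) j i k l x y + berwald_vert (?F' c) j k l x y * y $ i" for c j i k l x y
      by (simp add: berwald_hor_def)
  qed (use assms(3) hor13 vert03 parallel in auto)
qed

end
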